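(* There is an absolute constant $c>0$ such that for all integers $o\ge 3$ and $r\ge 3$, $$\mathrm{CR}(o,r)\le \left(\frac{c\, r^3}{\log r}\right)^{o-2}.$$
   Context: An edge-coloring of the complete graph $K_n$ is any map $\chi:E(K_n)\to\omega$ (arbitrarily many colors allowed). A clique is rainbow if all of its edges receive pairwise distinct colors. A coloring of a clique $K_s$ is called orderable if there is an ordering $v_1,\dots,v_s$ of its vertices such that $\chi(v_iv_j)=\chi(v_iv_k)$ for all $1\le i<j<k\le s$ (edges with the same lower endpoint have the same color; edges with different lower endpoints may or may not share colors). $\mathrm{CR}(o,r)$ is the minimum $n$ such that every edge-coloring $\chi:E(K_n)\to\omega$ contains either a clique of order $o$ whose coloring is orderable or a rainbow clique of order $r$. *)

theory Defs
  imports Complex_Main "HOL-Library.Ramsey" "HOL-Library.Extended_Real"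
begin

text \<open>
  An edge-coloring of a complete graph is a function on sets of vertices; only its values
  on two-element sets (the edges) matter. The cliques of order \<open>s\<close> in the complete graph
  on the vertex set \<open>V\<close> are the members of \<open>[V]\<^bsup>s\<^esup>\<close>, and \<open>[H]\<^bsup>2\<^esup>\<close> is the edge set of the clique \<open>H\<close>.
\<close>

definition rainbow_clique :: "('a set \<Rightarrow> 'c) \<Rightarrow> 'a set \<Rightarrow> bool" where
  "rainbow_clique \<chi> H \<longleftrightarrow> inj_on \<chi> ([H]\<^bsup>2\<^esup>)"

definition orderable_clique :: "('a set \<Rightarrow> 'c) \<Rightarrow> 'a set \<Rightarrow> bool" where
  "orderable_clique \<chi> H \<longleftrightarrow>
     (\<exists>vs. distinct vs \<and> set vs = H \<and>
        (\<forall>i j k. i < j \<and> j < k \<and> k < length vs \<longrightarrow>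
           \<chi> {vs ! i, vs ! j} = \<chi> {vs ! i, vs ! k}))"

definition CR_arrows :: "nat \<Rightarrow> nat \<Rightarrow> nat \<Rightarrow> bool" where
  "CR_arrows n m r \<longleftrightarrow>
     (\<forall>\<chi> :: nat set \<Rightarrow> nat.
        (\<exists>H \<in> [{..<n}]\<^bsup>m\<^esup>. orderable_clique \<chi> H) \<or>
        (\<exists>H \<in> [{..<n}]\<^bsup>r\<^esup>. rainbow_clique \<chi> H))"

text \<open>
  The minimum is taken in \<^typ>\<open>enat\<close>, so that it would be \<open>\<infinity>\<close> if no suitable \<open>n\<close> existed;
  a finite upper bound thus includes the existence of such an \<open>n\<close>. The order of the
  orderable clique is called \<open>m\<close> because \<open>o\<close> is reserved syntax for function composition.
\<close>

definition CR :: "nat \<Rightarrow> nat \<Rightarrow> enat" where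
  "CR m r = Inf (enat ` {n. CR_arrows n m r})"

end

theory Submission
  imports Defs "HOL-Real_Asymp.Real_Asymp"
begin

text \<open>
  If some vertex has more than \<open>X\<^sup>k\<close> neighbours in one color, with \<open>X\<close> of order
  \<open>r\<^sup>3 / ln r\<close>, recursion into that color neighbourhood lengthens the orderable clique by one.
  Otherwise all color degrees are at most \<open>d = X\<^sup>k \<le> n / X\<close>, and a rainbow clique is an
  independent set of the hypergraph whose edges are the equally colored pairs of disjoint edges
  (4-sets, every triple in at most \<open>3 d\<close> of them) and of adjacent edges (few 3-sets).

  For the factor \<open>ln r\<close>, sample vertices so that about \<open>q = r\<^bsup>17/16\<^esup>\<close> survive, and delete the few
  vertices in 3-sets, in 4-sets meeting in two or more points, or in linear triangles of 4-sets. In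
  what remains, let \<open>W\<close> be a uniformly random independent set. Resampling \<open>W\<close> on the link of a
  vertex \<open>v\<close> shows, as in Alon's and Shearer's arguments for triangle-free graphs, that either \<open>v\<close>
  is in \<open>W\<close> with probability at least \<open>r\<^bsup>-c\<^esup>\<close> or the expected number of 4-sets blocking \<open>v\<close> is at
  least of order \<open>ln r\<close>. On the other hand, fewer than \<open>r\<close> vertices contain few triples, each in
  few 4-sets, so they block few vertices on average. Truncating the number of blocking 4-sets at
  order \<open>ln r\<close> allows a union bound over all \<open>W\<close>, so this average passes from the whole vertex
  set to the sample, a contradiction unless some \<open>W\<close> has at least \<open>r\<close> vertices.
\<close>

section \<open>Random independent sets\<close>

text \<open>Think of \<open>S\<close> as uniform in \<open>Pow B\<close>. If at most
  \<open>K\<close> triples lie in \<open>B\<close>, then \<open>S\<close> misses a chosen point of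
  each with probability at least 2^-\<open>K\<close>, and the first summand suffices. Otherwise
  \<open>K\<close> of them each lie in \<open>S\<close> with probability 1/8, and the truncated
  count suffices.\<close>

lemma fibre_bound:
  fixes L :: "'a set set" and K :: nat
  assumes B: "finite B" and L: "\<And>t. t \<in> L \<Longrightarrow> card t = 3"
  shows "real K / 8 * 2 ^ card B \<le>
    (\<Sum>S\<in>Pow B. real K * 2 ^ K * of_bool (\<forall>t\<in>L. \<not> t \<subseteq> S) + real (min (card {t\<in>L. t \<subseteq> S}) K))"
proof -
  define T where "T = {t\<in>L. t \<subseteq> B}"
  have finT: "finite T" unfolding T_def by (rule finite_subset[of _ "Pow B"]) (use B in auto)
  show ?thesis
  proof (cases "card T \<le> K")
    case True
    have "\<exists>h. \<forall>t\<in>T. h t \<in> t"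
      using L by (intro bchoice ballI) (metis T_def mem_Collect_eq card.empty ex_in_conv zero_neq_numeral)
    then obtain h where h: "\<And>t. t \<in> T \<Longrightarrow> h t \<in> t" by blast
    define H where "H = h ` T"
    have H: "H \<subseteq> B" "finite H" "card H \<le> K"
      using h finT True card_image_le[OF finT, of h] by (auto simp: H_def T_def)
    have "(2::real) ^ card B = 2 ^ card H * 2 ^ card (B - H)"
      using H B by (metis card_Diff_subset card_mono le_add_diff_inverse power_add)
    also have "\<dots> \<le> 2 ^ K * 2 ^ card (B - H)"
      using H by (intro mult_right_mono power_increasing) auto
    finally have le: "(2::real) ^ card B \<le> 2 ^ K * 2 ^ card (B - H)" .
    have "real K / 8 * 2 ^ card B \<le> real K * 2 ^ card B"
      by (intro mult_right_mono) auto
    also have "\<dots> \<le> real K * (2 ^ K * 2 ^ card (B - H))"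
      using le by (intro mult_left_mono) auto
    also have "\<dots> = (\<Sum>S\<in>Pow (B - H). real K * 2 ^ K)"
      using B by (simp add: card_Pow)
    also have "\<dots> \<le> (\<Sum>S\<in>Pow (B - H). real K * 2 ^ K * of_bool (\<forall>t\<in>L. \<not> t \<subseteq> S) + real (min (card {t\<in>L. t \<subseteq> S}) K))"
    proof (rule sum_mono)
      fix S assume S: "S \<in> Pow (B - H)"
      have "\<forall>t\<in>L. \<not> t \<subseteq> S"
      proof (intro ballI notI)
        fix t assume "t \<in> L" "t \<subseteq> S"
        hence "t \<in> T" using S by (auto simp: T_def)
        thus False using h[of t] S \<open>t \<subseteq> S\<close> by (auto simp: H_def)
      qed
      thus "real K * 2 ^ K \<le> real K * 2 ^ K * of_bool (\<forall>t\<in>L. \<not> t \<subseteq> S) + real (min (card {t\<in>L. t \<subseteq> S}) K)"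
        by simp
    qed
    also have "\<dots> \<le> (\<Sum>S\<in>Pow B. real K * 2 ^ K * of_bool (\<forall>t\<in>L. \<not> t \<subseteq> S) + real (min (card {t\<in>L. t \<subseteq> S}) K))"
      using B by (intro sum_mono2) auto
    finally show ?thesis .
  next
    case False
    then obtain T' where T': "T' \<subseteq> T" "card T' = K"
      by (meson nat_le_linear obtain_subset_with_card_n)
    have finT': "finite T'" using T' finT finite_subset by blast
    have pow: "real (card {S\<in>Pow B. t \<subseteq> S}) = 2 ^ card B / 8" if "t \<in> T'" for t
    proof -
      have t: "t \<subseteq> B" "card t = 3" using that T' L by (auto simp: T_def)
      have "{S\<in>Pow B. t \<subseteq> S} = (\<lambda>S. t \<union> S) ` Pow (B - t)"
      proof (intro equalityI subsetI)
        fix S assume "S \<in> {S\<in>Pow B. t \<subseteq> S}"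
        then show "S \<in> (\<lambda>S. t \<union> S) ` Pow (B - t)"
          by (intro image_eqI[of _ _ "S - t"]) auto
      qed (use t in auto)
      moreover have "inj_on (\<lambda>S. t \<union> S) (Pow (B - t))" by (intro inj_onI) blast
      ultimately have "card {S\<in>Pow B. t \<subseteq> S} = 2 ^ card (B - t)"
        using B by (simp add: card_image card_Pow)
      moreover have "(2::real) ^ card B = 2 ^ card t * 2 ^ card (B - t)"
        using t B by (metis card_Diff_subset card_mono finite_subset le_add_diff_inverse power_add)
      ultimately show ?thesis using t by simp
    qed
    have "real K / 8 * 2 ^ card B = (\<Sum>t\<in>T'. 2 ^ card B / 8)" using T' by simp
    also have "\<dots> = (\<Sum>t\<in>T'. \<Sum>S\<in>Pow B. of_bool (t \<subseteq> S))"
      using B by (intro sum.cong) (auto simp: pow[symmetric] of_bool_def sum.If_cases Int_def)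
    also have "\<dots> = (\<Sum>S\<in>Pow B. \<Sum>t\<in>T'. of_bool (t \<subseteq> S))" by (rule sum.swap)
    also have "\<dots> = (\<Sum>S\<in>Pow B. real (card {t\<in>T'. t \<subseteq> S}))"
      using finT' by (intro sum.cong) (auto simp: of_bool_def sum.If_cases Int_def)
    also have "\<dots> \<le> (\<Sum>S\<in>Pow B. real K * 2 ^ K * of_bool (\<forall>t\<in>L. \<not> t \<subseteq> S) + real (min (card {t\<in>L. t \<subseteq> S}) K))"
    proof (rule sum_mono)
      fix S assume S: "S \<in> Pow B"
      have "finite {t\<in>L. t \<subseteq> S}"
        by (rule finite_subset[of _ "Pow B"]) (use B S in auto)
      hence "card {t\<in>T'. t \<subseteq> S} \<le> card {t\<in>L. t \<subseteq> S}"
        using T' by (intro card_mono) (auto simp: T_def)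
      \<comment> \<open>\<open>T'\<close> has only \<open>K\<close> members, so truncating the count
        at \<open>K\<close> loses nothing on it.\<close>
      moreover have "card {t\<in>T'. t \<subseteq> S} \<le> K"
        using T' finT' card_mono[of T' "{t\<in>T'. t \<subseteq> S}"] by auto
      ultimately have "real (card {t\<in>T'. t \<subseteq> S}) \<le> real (min (card {t\<in>L. t \<subseteq> S}) K)" by simp
      moreover have "0 \<le> real K * 2 ^ K * of_bool (\<forall>t\<in>L. \<not> t \<subseteq> S)" by simp
      ultimately show "real (card {t\<in>T'. t \<subseteq> S}) \<le> real K * 2 ^ K * of_bool (\<forall>t\<in>L. \<not> t \<subseteq> S) + real (min (card {t\<in>L. t \<subseteq> S}) K)"
        by linarith
    qed
    finally show ?thesis .
  qed
qed

section \<open>Independent sets and the link of a vertex\<close>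

definition indep :: "'a set set \<Rightarrow> 'a set \<Rightarrow> bool" where
  "indep E W \<longleftrightarrow> (\<forall>e\<in>E. \<not> e \<subseteq> W)"

text \<open>The edges that block \<open>v\<close>: for \<open>v\<close> outside a finite independent
  \<open>W\<close>, the set \<open>insert v W\<close> is independent exactly if this number is
  0.\<close>

definition conflicts :: "'a set set \<Rightarrow> 'a set \<Rightarrow> 'a \<Rightarrow> nat" where
  "conflicts E W v = card {e\<in>E. v \<in> e \<and> e - {v} \<subseteq> W}"

lemma indep_subset: "indep E W \<Longrightarrow> S \<subseteq> W \<Longrightarrow> indep E S"
  unfolding indep_def by blast

text \<open>Fix \<open>W\<close> outside the union \<open>N\<close> of the link triples of
  \<open>v\<close>. By \<open>unc\<close>, where \<open>f\<close> = \<open>g\<close> is allowed, an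
  edge inside \<open>U\<close> avoiding \<open>v\<close> has at most one point in \<open>N\<close>.
  Hence resampling \<open>W\<close> on \<open>N\<close> is a free choice of a subset of
  \<open>Q\<close>, to which \<open>fibre_bound\<close> applies; summing over the fibres gives the
  claim.\<close>

lemma vertex_bound:
  fixes E :: "'a set set" and K :: nat
  assumes U: "finite U" and E: "\<And>e. e \<in> E \<Longrightarrow> card e = 4"
    and unc: "\<And>e f g x y. e \<in> E \<Longrightarrow> f \<in> E \<Longrightarrow> g \<in> E \<Longrightarrow> e \<subseteq> U \<Longrightarrow> f \<subseteq> U \<Longrightarrow> g \<subseteq> U \<Longrightarrow>
        v \<notin> e \<Longrightarrow> v \<in> f \<Longrightarrow> v \<in> g \<Longrightarrow> x \<in> e \<Longrightarrow> x \<in> f \<Longrightarrow> y \<in> e \<Longrightarrow> y \<in> g \<Longrightarrow> x = y"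
    and v: "v \<in> U"
  defines "R \<equiv> {W. W \<subseteq> U \<and> v \<notin> W \<and> indep E W}"
  shows "real K / 8 * real (card R) \<le>
    (\<Sum>W\<in>R. real K * 2 ^ K * of_bool (indep E (insert v W)) + real (min (conflicts E W v) K))"
    (is "_ \<le> sum ?f R")
proof -
  define L where "L = (\<lambda>e. e - {v}) ` {e\<in>E. v \<in> e \<and> e \<subseteq> U}"
  define N where "N = \<Union>L"
  have cardL: "card t = 3" if "t \<in> L" for t
    using that E by (auto simp: L_def)
  have vN: "v \<notin> N" and NU: "N \<subseteq> U" by (auto simp: N_def L_def)
  have finR: "finite R" unfolding R_def using U by (auto intro: finite_subset[of _ "Pow U"])
  have fib: "real K / 8 * real (card {W\<in>R. W - N = W0}) \<le> (\<Sum>W\<in>{W\<in>R. W - N = W0}. ?f W)"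
    if "W0 \<in> (\<lambda>W. W - N) ` R" for W0
  proof -
    have W0: "W0 \<subseteq> U" "v \<notin> W0" "W0 \<inter> N = {}" "indep E W0"
      using that by (auto simp: R_def intro: indep_subset)
    \<comment> \<open>Points of \<open>N\<close> that can be added to \<open>W0\<close> one at a
      time; \<open>indQ\<close> shows that they can be added in any combination.\<close>
    define Q where "Q = {x\<in>N. indep E (insert x W0)}"
    have "finite N" using NU U finite_subset by blast
    hence Q: "Q \<subseteq> N" "finite Q" by (auto simp: Q_def)
    have indQ: "indep E (W0 \<union> S)" if S: "S \<subseteq> Q" for S
      unfolding indep_def
    proof (intro ballI notI)
      fix e assume e: "e \<in> E" "e \<subseteq> W0 \<union> S"
      have eU: "e \<subseteq> U" "v \<notin> e" using e W0 S Q NU vN by blast+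
      show False
      proof (cases "e \<inter> S = {}")
        case True
        thus False using e W0 unfolding indep_def by blast
      next
        case False
        then obtain x where x: "x \<in> e" "x \<in> S" by blast
        have "y = x" if y: "y \<in> e" "y \<in> S" for y
        proof -
          have "x \<in> N" "y \<in> N" using x y S Q by auto
          then obtain f g where "f \<in> E" "v \<in> f" "f \<subseteq> U" "x \<in> f" "g \<in> E" "v \<in> g" "g \<subseteq> U" "y \<in> g"
            by (auto simp: N_def L_def)
          thus ?thesis using unc[of e g f y x] e eU x y by blast
        qed
        hence "e \<subseteq> insert x W0" using e by blast
        thus False using x S e unfolding Q_def indep_def by blast
      qed
    qed
    \<comment> \<open>The fibre over \<open>W0\<close> is a full Boolean cube, so a uniform
      \<open>W\<close> in it is a uniform subset of \<open>Q\<close>.\<close>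
    have eq: "{W\<in>R. W - N = W0} = (\<lambda>S. W0 \<union> S) ` Pow Q"
    proof (intro equalityI subsetI)
      fix W assume W: "W \<in> {W\<in>R. W - N = W0}"
      have "W \<inter> N \<subseteq> Q"
        using W unfolding Q_def R_def by (auto elim!: indep_subset)
      thus "W \<in> (\<lambda>S. W0 \<union> S) ` Pow Q"
        using W by (intro image_eqI[of _ _ "W \<inter> N"]) auto
    next
      fix W assume "W \<in> (\<lambda>S. W0 \<union> S) ` Pow Q"
      then obtain S where S: "S \<subseteq> Q" "W = W0 \<union> S" by auto
      thus "W \<in> {W\<in>R. W - N = W0}"
        using W0 Q NU vN indQ[OF S(1)] by (auto simp: R_def)
    qed
    have inj: "inj_on (\<lambda>S. W0 \<union> S) (Pow Q)"
      using W0 Q by (intro inj_onI) blast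
    have val: "real K * 2 ^ K * of_bool (\<forall>t\<in>L. \<not> t \<subseteq> S) + real (min (card {t\<in>L. t \<subseteq> S}) K) \<le> ?f (W0 \<union> S)"
      if S: "S \<in> Pow Q" for S
    proof -
      have WU: "W0 \<union> S \<subseteq> U" using S W0 Q NU by auto
      \<comment> \<open>Link triples lie in \<open>N\<close>, which is disjoint from
        \<open>W0\<close>, so whether \<open>v\<close> is blocked depends on \<open>S\<close>
        alone.\<close>
      have tS: "t \<subseteq> S" if "t \<in> L" "t \<subseteq> W0 \<union> S" for t
        using that W0 by (auto simp: N_def)
      have "indep E (insert v (W0 \<union> S))" if no: "\<forall>t\<in>L. \<not> t \<subseteq> S"
        unfolding indep_def
      proof (intro ballI notI)
        fix e assume e: "e \<in> E" "e \<subseteq> insert v (W0 \<union> S)"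
        show False
        proof (cases "v \<in> e")
          case True
          hence "e - {v} \<in> L" using e WU v by (auto simp: L_def)
          moreover have "e - {v} \<subseteq> W0 \<union> S" using e by auto
          ultimately show False using tS no by blast
        next
          case False
          hence "e \<subseteq> W0 \<union> S" using e by auto
          thus False using indQ S e by (auto simp: indep_def)
        qed
      qed
      moreover have "card {t\<in>L. t \<subseteq> S} \<le> conflicts E (W0 \<union> S) v"
      proof -
        have "{t\<in>L. t \<subseteq> S} \<subseteq> (\<lambda>e. e - {v}) ` {e\<in>E. v \<in> e \<and> e - {v} \<subseteq> W0 \<union> S}"
          by (auto simp: L_def)
        moreover have fin: "finite {e\<in>E. v \<in> e \<and> e - {v} \<subseteq> W0 \<union> S}"
          by (rule finite_subset[of _ "Pow U"]) (use U WU v in auto)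
        ultimately have "card {t\<in>L. t \<subseteq> S} \<le> card ((\<lambda>e. e - {v}) ` {e\<in>E. v \<in> e \<and> e - {v} \<subseteq> W0 \<union> S})"
          by (intro card_mono) auto
        also have "\<dots> \<le> conflicts E (W0 \<union> S) v"
          unfolding conflicts_def using fin by (rule card_image_le)
        finally show ?thesis .
      qed
      ultimately show ?thesis
        by (intro add_mono mult_left_mono) (auto simp: of_bool_def)
    qed
    have "real K / 8 * real (card {W\<in>R. W - N = W0}) = real K / 8 * 2 ^ card Q"
      unfolding eq using Q inj by (simp add: card_image card_Pow)
    also have "\<dots> \<le> (\<Sum>S\<in>Pow Q. real K * 2 ^ K * of_bool (\<forall>t\<in>L. \<not> t \<subseteq> S) + real (min (card {t\<in>L. t \<subseteq> S}) K))"
      using Q cardL by (intro fibre_bound) auto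
    also have "\<dots> \<le> (\<Sum>S\<in>Pow Q. ?f (W0 \<union> S))" by (intro sum_mono val)
    also have "\<dots> = (\<Sum>W\<in>{W\<in>R. W - N = W0}. ?f W)"
      unfolding eq using inj by (subst sum.reindex) auto
    finally show ?thesis .
  qed
  have "real K / 8 * real (card R) = (\<Sum>W\<in>R. real K / 8)" by simp
  also have "\<dots> = (\<Sum>W0\<in>(\<lambda>W. W - N) ` R. \<Sum>W\<in>{W\<in>R. W - N = W0}. real K / 8)"
    using finR by (rule sum.image_gen)
  also have "\<dots> \<le> (\<Sum>W0\<in>(\<lambda>W. W - N) ` R. \<Sum>W\<in>{W\<in>R. W - N = W0}. ?f W)"
  proof (rule sum_mono)
    fix W0 assume "W0 \<in> (\<lambda>W. W - N) ` R"
    thus "(\<Sum>W\<in>{W\<in>R. W - N = W0}. real K / 8) \<le> (\<Sum>W\<in>{W\<in>R. W - N = W0}. ?f W)"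
      using fib[of W0] by (subst sum_constant) (simp only: mult.commute)
  qed
  also have "\<dots> = sum ?f R"
    using finR by (rule sum.image_gen[symmetric])
  finally show ?thesis .
qed

text \<open>Sum \<open>vertex_bound\<close> over all \<open>v\<close> and average over all
  independent sets. Passing from the sets without \<open>v\<close> to all of them turns
  \<open>K\<close> / 8 into \<open>K\<close> / 16, since deleting \<open>v\<close> maps the others
  injectively into the former.\<close>

lemma ex_independent_many_conflicts:
  fixes E :: "'a set set" and K :: nat
  assumes U: "finite U" and E: "\<And>e. e \<in> E \<Longrightarrow> card e = 4"
    and unc: "\<And>v e f g x y. e \<in> E \<Longrightarrow> f \<in> E \<Longrightarrow> g \<in> E \<Longrightarrow> e \<subseteq> U \<Longrightarrow> f \<subseteq> U \<Longrightarrow> g \<subseteq> U \<Longrightarrow>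
        v \<notin> e \<Longrightarrow> v \<in> f \<Longrightarrow> v \<in> g \<Longrightarrow> x \<in> e \<Longrightarrow> x \<in> f \<Longrightarrow> y \<in> e \<Longrightarrow> y \<in> g \<Longrightarrow> x = y"
  shows "\<exists>W\<subseteq>U. indep E W \<and>
    real (card U) * real K / 16 \<le>
      real K * 2 ^ K * real (card W) + (\<Sum>v\<in>U - W. real (min (conflicts E W v) K))"
proof (rule ccontr)
  assume neg: "\<not> ?thesis"
  define I where "I = {W. W \<subseteq> U \<and> indep E W}"
  \<comment> \<open>The charge of \<open>v\<close> in \<open>W\<close>: for fixed \<open>W\<close>
    it sums over \<open>v\<close> to the right-hand side of the claim (\<open>eqh\<close>), for
    fixed \<open>v\<close> its sum over \<open>W\<close> is what \<open>vertex_bound\<close>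
    controls.\<close>
  define h where "h W v = real K * 2 ^ K * of_bool (v \<in> W) + of_bool (v \<notin> W) * real (min (conflicts E W v) K)" for W v
  have finI: "finite I" unfolding I_def using U by (auto intro: finite_subset[of _ "Pow U"])
  \<comment> \<open>\<open>I\<close> must be nonempty for the strict inequality between sums below;
    the empty set qualifies because edges have 4 points.\<close>
  have "indep E {}" unfolding indep_def using E by (metis card.empty subset_empty zero_neq_numeral)
  hence I0: "{} \<in> I" by (auto simp: I_def)
  have v: "real K / 16 * real (card I) \<le> (\<Sum>W\<in>I. h W v)" if v: "v \<in> U" for v
  proof -
    define R where "R = {W. W \<subseteq> U \<and> v \<notin> W \<and> indep E W}"
    define R' where "R' = {W\<in>R. indep E (insert v W)}"
    have fin: "finite R" "finite R'" 
      by (rule finite_subset[OF _ finI]; auto simp: R_def R'_def I_def)+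
    have I: "I = R \<union> insert v ` R'"
    proof (intro equalityI subsetI)
      fix W assume W: "W \<in> I"
      show "W \<in> R \<union> insert v ` R'"
      proof (cases "v \<in> W")
        case True
        hence "W - {v} \<in> R'" using W by (auto simp: I_def R_def R'_def insert_absorb intro: indep_subset)
        moreover have "W = insert v (W - {v})" using True by auto
        ultimately show ?thesis by blast
      qed (use W in \<open>auto simp: I_def R_def\<close>)
    qed (use v in \<open>auto simp: I_def R_def R'_def\<close>)
    have inj: "inj_on (insert v) R'" 
      by (intro inj_onI) (auto simp: R'_def R_def)
    have disj: "R \<inter> insert v ` R' = {}" by (auto simp: R_def)
    have "card I = card R + card R'"
      unfolding I using fin disj inj by (subst card_Un_disjoint) (auto simp: card_image)
    moreover have "card R' \<le> card R" using fin by (intro card_mono) (auto simp: R'_def)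
    ultimately have "real (card I) \<le> 2 * real (card R)" by linarith
    hence "real K / 16 * real (card I) \<le> real K / 16 * (2 * real (card R))"
      by (rule mult_left_mono) simp
    also have "\<dots> = real K / 8 * real (card R)" by simp
    also have "\<dots> \<le> (\<Sum>W\<in>R. real K * 2 ^ K * of_bool (indep E (insert v W)) + real (min (conflicts E W v) K))"
      unfolding R_def by (rule vertex_bound) (use assms v in blast)+
    also have "\<dots> = real K * 2 ^ K * real (card R') + (\<Sum>W\<in>R. real (min (conflicts E W v) K))"
      using fin by (simp add: sum.distrib sum_distrib_left[symmetric] of_bool_def sum.If_cases R'_def Int_def)
    also have "\<dots> = (\<Sum>W\<in>insert v ` R'. h W v) + (\<Sum>W\<in>R. h W v)"
      using inj by (subst sum.reindex) (auto simp: h_def R_def intro!: sum.cong)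
    also have "\<dots> = (\<Sum>W\<in>I. h W v)"
      unfolding I using fin disj by (subst sum.union_disjoint) (auto simp: Int_commute)
    finally show ?thesis .
  qed
  have eqh: "(\<Sum>v\<in>U. h W v) = real K * 2 ^ K * real (card W) + (\<Sum>v\<in>U - W. real (min (conflicts E W v) K))"
    if "W \<in> I" for W
  proof -
    have W: "W \<subseteq> U" using that by (auto simp: I_def)
    have "(\<Sum>v\<in>U. h W v) = (\<Sum>v\<in>U - W. h W v) + (\<Sum>v\<in>W. h W v)"
      using W U by (rule sum.subset_diff)
    thus ?thesis by (simp add: h_def)
  qed
  have "real (card U) * real K / 16 * real (card I) = (\<Sum>v\<in>U. real K / 16 * real (card I))" by simp
  also have "\<dots> \<le> (\<Sum>v\<in>U. \<Sum>W\<in>I. h W v)" using v by (rule sum_mono)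
  also have "\<dots> = (\<Sum>W\<in>I. \<Sum>v\<in>U. h W v)" by (rule sum.swap)
  also have "\<dots> < (\<Sum>W\<in>I. real (card U) * real K / 16)"
    using finI I0 neg eqh by (intro sum_strict_mono) (auto simp: I_def not_le)
  also have "\<dots> = real (card U) * real K / 16 * real (card I)" by simp
  finally show False by simp
qed

section \<open>Random samples of vertices\<close>

text \<open>The expectation of \<open>f A\<close> for a random subset \<open>A\<close> of
  \<open>V\<close> that keeps each vertex independently with probability \<open>p\<close>.\<close>

definition sample_mean :: "real \<Rightarrow> 'a set \<Rightarrow> ('a set \<Rightarrow> real) \<Rightarrow> real" where
  "sample_mean p V f = (\<Sum>A\<in>Pow V. p ^ card A * (1 - p) ^ card (V - A) * f A)"

text \<open>Expand a product over \<open>V\<close> whose factors are the weight \<open>a i\<close>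
  of keeping \<open>i\<close> plus the weight \<open>b i\<close> of dropping it. Setting
  \<open>b i\<close> to 0 on \<open>S\<close> forces \<open>A\<close> to contain
  \<open>S\<close>.\<close>

lemma sample_mean_prod:
  assumes V: "finite V" and S: "S \<subseteq> V"
  shows "sample_mean p V (\<lambda>A. of_bool (S \<subseteq> A) * (\<Prod>i\<in>A - S. g i)) =
    p ^ card S * (\<Prod>i\<in>V - S. 1 - p + p * g i)"
proof -
  define a where "a i = (if i \<in> S then p else p * g i)" for i
  define b where "b i = (if i \<in> S then 0 else 1 - p)" for i
  have "(\<Prod>i\<in>V. a i + b i) = (\<Prod>i\<in>V - S. a i + b i) * (\<Prod>i\<in>S. a i + b i)"
    using V S by (intro prod.subset_diff)
  also have "\<dots> = p ^ card S * (\<Prod>i\<in>V - S. 1 - p + p * g i)"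
    by (simp add: a_def b_def add.commute)
  finally have *: "p ^ card S * (\<Prod>i\<in>V - S. 1 - p + p * g i) = (\<Prod>i\<in>V. a i + b i)" ..
  have "(\<Prod>i\<in>V. a i + b i) = (\<Sum>A\<in>Pow V. prod a A * prod b (V - A))"
    using V by (rule prod_add)
  also have "\<dots> = sample_mean p V (\<lambda>A. of_bool (S \<subseteq> A) * (\<Prod>i\<in>A - S. g i))"
    unfolding sample_mean_def
  proof (rule sum.cong)
    fix A assume A: "A \<in> Pow V"
    have fin: "finite A" "finite (V - A)" using A V finite_subset by auto
    show "prod a A * prod b (V - A) =
      p ^ card A * (1 - p) ^ card (V - A) * (of_bool (S \<subseteq> A) * (\<Prod>i\<in>A - S. g i))"
    proof (cases "S \<subseteq> A")
      case True
      have "prod a A = (\<Prod>i\<in>A - S. a i) * (\<Prod>i\<in>S. a i)"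
        using fin True by (intro prod.subset_diff)
      also have "\<dots> = p ^ card (A - S) * (\<Prod>i\<in>A - S. g i) * p ^ card S"
        by (simp add: a_def prod.distrib)
      also have "\<dots> = p ^ card A * (\<Prod>i\<in>A - S. g i)"
        using True fin by (simp add: card_Diff_subset finite_subset card_mono flip: power_add)
      moreover have "prod b (V - A) = (\<Prod>i\<in>V - A. 1 - p)"
        using True by (intro prod.cong) (auto simp: b_def)
      ultimately show ?thesis using True by simp
    next
      case False
      hence "prod b (V - A) = 0"
        using fin S by (auto simp: b_def)
      thus ?thesis using False by simp
    qed
  qed simp
  finally show ?thesis using * by simp
qed

lemma sample_mean_const: "finite V \<Longrightarrow> sample_mean p V (\<lambda>A. c) = c"
  using sample_mean_prod[of V "{}" p "\<lambda>_. 1"]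
  by (simp add: sample_mean_def flip: sum_distrib_right)

lemma sample_mean_subset:
  "finite V \<Longrightarrow> S \<subseteq> V \<Longrightarrow> sample_mean p V (\<lambda>A. of_bool (S \<subseteq> A)) = p ^ card S"
  using sample_mean_prod[of V S p "\<lambda>_. 1"] by simp

lemma sample_mean_add: "sample_mean p V (\<lambda>A. f A + g A) = sample_mean p V f + sample_mean p V g"
  by (simp add: sample_mean_def distrib_left sum.distrib)

lemma sample_mean_cmult: "sample_mean p V (\<lambda>A. c * f A) = c * sample_mean p V f"
  by (simp add: sample_mean_def sum_distrib_left mult_ac)

lemma sample_mean_sum: "sample_mean p V (\<lambda>A. \<Sum>i\<in>I. f i A) = (\<Sum>i\<in>I. sample_mean p V (f i))"
  unfolding sample_mean_def sum_distrib_left by (rule sum.swap)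

lemma sample_mean_lt_imp_ex:
  assumes V: "finite V" and p: "0 \<le> p" "p \<le> 1" and lt: "sample_mean p V f < c"
  shows "\<exists>A\<subseteq>V. f A < c"
proof (rule ccontr)
  assume "\<not> ?thesis"
  hence "sample_mean p V (\<lambda>A. c) \<le> sample_mean p V f"
    unfolding sample_mean_def using p
    by (intro sum_mono mult_left_mono) (auto simp: not_less)
  thus False using lt V by (simp add: sample_mean_const)
qed

text \<open>A moment generating function as in Chernoff's bound, on the event that \<open>S\<close>
  is sampled. By independence it splits into factors, and exp y <= 1 + y + y^2 <= 1 + 2 y on [0, 1]
  bounds each of them.\<close>

lemma sample_mean_exp_le:
  assumes V: "finite V" and S: "S \<subseteq> V" and p: "0 \<le> p" "p \<le> 1" and y: "\<And>i. i \<in> V - S \<Longrightarrow> 0 \<le> y i \<and> y i \<le> 1"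
  shows "sample_mean p V (\<lambda>A. of_bool (S \<subseteq> A) * exp (\<Sum>i\<in>A - S. y i)) \<le>
    p ^ card S * exp (2 * p * (\<Sum>i\<in>V - S. y i))"
proof -
  have "sample_mean p V (\<lambda>A. of_bool (S \<subseteq> A) * exp (\<Sum>i\<in>A - S. y i)) =
      sample_mean p V (\<lambda>A. of_bool (S \<subseteq> A) * (\<Prod>i\<in>A - S. exp (y i)))"
    unfolding sample_mean_def using V 
    by (intro sum.cong) (auto simp: exp_sum finite_subset)
  also have "\<dots> = p ^ card S * (\<Prod>i\<in>V - S. 1 - p + p * exp (y i))"
    by (rule sample_mean_prod[OF V S])
  also have "\<dots> \<le> p ^ card S * (\<Prod>i\<in>V - S. exp (2 * p * y i))"
  proof (intro mult_left_mono prod_mono conjI)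
    fix i assume i: "i \<in> V - S"
    have "exp (y i) \<le> 1 + y i + (y i)\<^sup>2" using y[OF i] by (intro exp_bound) auto
    moreover have "(y i)\<^sup>2 \<le> y i" using y[OF i] by (simp add: power2_eq_square mult_left_le)
    ultimately have "p * exp (y i) \<le> p * (1 + 2 * y i)" using p by (intro mult_left_mono) auto
    hence "1 - p + p * exp (y i) \<le> 1 + 2 * p * y i" by (simp add: algebra_simps)
    also have "\<dots> \<le> exp (2 * p * y i)" by (rule exp_ge_add_one_self)
    finally show "1 - p + p * exp (y i) \<le> exp (2 * p * y i)" .
  qed (use p in auto)
  also have "\<dots> = p ^ card S * exp (2 * p * (\<Sum>i\<in>V - S. y i))"
    using V by (simp add: exp_sum sum_distrib_left)
  finally show ?thesis .
qed

text \<open>The lower-tail counterpart, which rules out small samples: exp (-1) <= 1/2 makes each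
  factor at most 1 - p/2 <= exp (-p/2).\<close>

lemma sample_mean_exp_neg_card_le:
  assumes V: "finite V" and p: "0 \<le> p" "p \<le> 1"
  shows "sample_mean p V (\<lambda>A. exp (- real (card A))) \<le> exp (- (p * real (card V) / 2))"
proof -
  have e2: "(2::real) \<le> exp 1" using exp_ge_add_one_self[of 1] by simp
  have e: "exp (-1) \<le> (1/2::real)" using e2 by (simp add: exp_minus field_simps)
  have "sample_mean p V (\<lambda>A. exp (- real (card A))) =
      sample_mean p V (\<lambda>A. of_bool ({} \<subseteq> A) * (\<Prod>i\<in>A - {}. exp (- 1)))"
    unfolding sample_mean_def using exp_of_nat_mult[where 'a = real, of _ "-1"] by simp
  also have "\<dots> = (1 - p + p * exp (-1)) ^ card V"
    using V by (subst sample_mean_prod) auto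
  also have "\<dots> \<le> (exp (- p / 2)) ^ card V"
  proof (rule power_mono)
    have "p * exp (-1) \<le> p * (1/2)" using p e by (intro mult_left_mono) auto
    hence "1 - p + p * exp (-1) \<le> 1 + (- p / 2)" by simp
    also have "\<dots> \<le> exp (- p / 2)" by (rule exp_ge_add_one_self)
    finally show "1 - p + p * exp (-1) \<le> exp (- p / 2)" .
  qed (use p in auto)
  also have "\<dots> = exp (- (p * real (card V) / 2))"
    by (simp flip: exp_of_nat_mult)
  finally show ?thesis .
qed

lemma sample_mean_card:
  assumes "finite V" "\<And>C. C \<in> P \<Longrightarrow> C \<subseteq> V \<and> card C = k"
  shows "sample_mean p V (\<lambda>A. real (card {C\<in>P. C \<subseteq> A})) = real (card P) * p ^ k"
proof -
  have P: "finite P" using assms by (intro finite_subset[of P "Pow V"]) auto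
  have "(\<lambda>A. real (card {C\<in>P. C \<subseteq> A})) = (\<lambda>A. \<Sum>C\<in>P. of_bool (C \<subseteq> A))"
    using P by (simp add: of_bool_def sum.If_cases Int_def)
  hence "sample_mean p V (\<lambda>A. real (card {C\<in>P. C \<subseteq> A})) = (\<Sum>C\<in>P. sample_mean p V (\<lambda>A. of_bool (C \<subseteq> A)))"
    by (simp only: sample_mean_sum)
  also have "\<dots> = (\<Sum>C\<in>P. p ^ k)"
    using assms by (intro sum.cong) (simp_all add: sample_mean_subset)
  finally show ?thesis by simp
qed

lemma binomial_le_power: "n choose k \<le> n ^ k"
  by (cases "k \<le> n") (simp_all add: binomial_le_pow binomial_eq_0)

text \<open>The total weight in the union bound over small sets: there are at most |V|^w sets of
  size w, each sampled with probability p^w, and (|V| p)^w <= (|V| p)^r because |V| p >= 1.\<close>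

lemma sum_pow_card_le:
  fixes p :: real
  assumes V: "finite V" and p: "0 \<le> p" and q: "1 \<le> real (card V) * p"
  shows "(\<Sum>W\<in>{W. W \<subseteq> V \<and> card W < r}. p ^ card W) \<le> real r * (real (card V) * p) ^ r"
proof -
  let ?S = "{W. W \<subseteq> V \<and> card W < r}"
  have fin: "finite ?S" by (rule finite_subset[of _ "Pow V"]) (use V in auto)
  have "(\<Sum>W\<in>?S. p ^ card W) = (\<Sum>w\<in>{..<r}. \<Sum>W\<in>{W\<in>?S. card W = w}. p ^ card W)"
    by (rule sum.group[symmetric]) (use fin in auto)
  also have "\<dots> \<le> (\<Sum>w\<in>{..<r}. (real (card V) * p) ^ r)"
  proof (rule sum_mono)
    fix w assume w: "w \<in> {..<r}"
    have "{W\<in>?S. card W = w} = {W. W \<subseteq> V \<and> card W = w}" using w by auto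
    hence "(\<Sum>W\<in>{W\<in>?S. card W = w}. p ^ card W) = real (card V choose w) * p ^ w"
      using V by (simp add: n_subsets)
    also have "\<dots> \<le> real (card V ^ w) * p ^ w"
      using p binomial_le_power by (intro mult_right_mono of_nat_mono) auto
    also have "\<dots> = (real (card V) * p) ^ w" by (simp add: power_mult_distrib)
    also have "\<dots> \<le> (real (card V) * p) ^ r" using w q by (intro power_increasing) auto
    finally show "(\<Sum>W\<in>{W\<in>?S. card W = w}. p ^ card W) \<le> (real (card V) * p) ^ r" .
  qed
  finally show ?thesis by simp
qed

section \<open>Sparse 4-uniform hypergraphs\<close>

lemma card_SigmaI_le:
  assumes A: "finite A" and B: "\<And>a. a \<in> A \<Longrightarrow> finite (B a)" "\<And>a. a \<in> A \<Longrightarrow> real (card (B a)) \<le> M"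
  shows "real (card (Sigma A B)) \<le> real (card A) * M"
proof -
  have "real (card (Sigma A B)) = (\<Sum>a\<in>A. real (card (B a)))"
    using A B(1) by simp
  also have "\<dots> \<le> (\<Sum>a\<in>A. M)" by (intro sum_mono B(2))
  finally show ?thesis by simp
qed

text \<open>For colorings, \<open>E\<close> will hold the equally colored pairs of disjoint edges
  and \<open>F\<close> those of adjacent edges. The quotient of \<open>D\<close> by the number of
  vertices acts as a common density of both.\<close>

locale sparse_hypergraph =
  fixes V :: "'a set" and E F :: "'a set set" and D :: real
  assumes finV: "finite V"
    and E: "E \<subseteq> [V]\<^bsup>4\<^esup>"
    and F: "F \<subseteq> [V]\<^bsup>3\<^esup>"
    and D: "0 \<le> D"
    and deg3: "S \<in> [V]\<^bsup>3\<^esup> \<Longrightarrow> real (card {e\<in>E. S \<subseteq> e}) \<le> D"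
    and cardF: "real (card F) \<le> D * real (card V) ^ 2"
begin

abbreviation "n \<equiv> real (card V)"

lemma finE: "finite E" and finF: "finite F"
  using finite_subset[OF E] finite_subset[OF F] finV by (auto intro: finite_imp_finite_nsets)

lemma E_card: "e \<in> E \<Longrightarrow> card e = 4" and E_sub: "e \<in> E \<Longrightarrow> e \<subseteq> V" and E_fin: "e \<in> E \<Longrightarrow> finite e"
  using E by (auto simp: nsets_def)

text \<open>Downward induction from triples: every edge containing a smaller \<open>S\<close>
  contains \<open>insert x S\<close> for one of at most \<open>n\<close> vertices \<open>x\<close>,
  so each step down costs a factor \<open>n\<close>.\<close>

lemma deg_le:
  assumes "j \<le> 3" "S \<in> [V]\<^bsup>j\<^esup>"
  shows "real (card {e\<in>E. S \<subseteq> e}) \<le> D * n ^ (3 - j)"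
  using assms
proof (induction j arbitrary: S rule: inc_induct)
  case base
  then show ?case using deg3[of S] by simp
next
  case (step j)
  have S: "S \<subseteq> V" "finite S" "card S = j" using step.prems by (auto simp: nsets_def)
  have "{e\<in>E. S \<subseteq> e} \<subseteq> snd ` Sigma (V - S) (\<lambda>x. {e\<in>E. insert x S \<subseteq> e})"
  proof
    fix e assume e: "e \<in> {e\<in>E. S \<subseteq> e}"
    have "card S < card e" using e E_card[of e] S(3) step.hyps by simp
    hence "\<not> e \<subseteq> S" using card_mono[OF S(2), of e] by linarith
    then obtain x where "x \<in> e" "x \<notin> S" by blast
    hence "(x, e) \<in> Sigma (V - S) (\<lambda>x. {e\<in>E. insert x S \<subseteq> e})"
      using e E_sub[of e] by auto
    thus "e \<in> snd ` Sigma (V - S) (\<lambda>x. {e\<in>E. insert x S \<subseteq> e})"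
      by (rule rev_image_eqI) simp
  qed
  hence "card {e\<in>E. S \<subseteq> e} \<le> card (snd ` Sigma (V - S) (\<lambda>x. {e\<in>E. insert x S \<subseteq> e}))"
    using finV finE by (intro card_mono) auto
  also have "\<dots> \<le> card (Sigma (V - S) (\<lambda>x. {e\<in>E. insert x S \<subseteq> e}))"
    using finV finE by (intro card_image_le) auto
  finally have "real (card {e\<in>E. S \<subseteq> e}) \<le> real (card (Sigma (V - S) (\<lambda>x. {e\<in>E. insert x S \<subseteq> e})))"
    by (rule of_nat_mono)
  also have "\<dots> \<le> real (card (V - S)) * (D * n ^ (3 - Suc j))"
  proof (rule card_SigmaI_le)
    fix x assume "x \<in> V - S"
    hence "insert x S \<in> [V]\<^bsup>Suc j\<^esup>" using S by (auto simp: nsets_def)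
    thus "real (card {e\<in>E. insert x S \<subseteq> e}) \<le> D * n ^ (3 - Suc j)" by (rule step.IH)
  qed (use finV finE in auto)
  also have "\<dots> \<le> n * (D * n ^ (3 - Suc j))"
    using D card_mono[OF finV, of "V - S"] by (intro mult_right_mono) auto
  also have "\<dots> = D * n ^ Suc (3 - Suc j)" by simp
  also have "Suc (3 - Suc j) = 3 - j" using step.hyps by (rule_tac Suc_diff_Suc) simp
  finally show ?case .
qed

lemma cardE: "real (card E) \<le> D * n ^ 3"
  using deg_le[of 0 "{}"] by (simp add: nsets_def)

lemma deg1: "x \<in> V \<Longrightarrow> real (card {e\<in>E. x \<in> e}) \<le> D * n ^ 2"
  using deg_le[of 1 "{x}"] by (simp add: nsets_def)

lemma deg2: "x \<in> V \<Longrightarrow> y \<in> V \<Longrightarrow> x \<noteq> y \<Longrightarrow> real (card {e\<in>E. x \<in> e \<and> y \<in> e}) \<le> D * n"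
  using deg_le[of 2 "{x, y}"] by (simp add: nsets_def)

section \<open>Pairs of edges with a given overlap, and triangles of edges\<close>

definition close_pairs :: "nat \<Rightarrow> ('a set \<times> 'a set) set" where
  "close_pairs j = {(e, f). e \<in> E \<and> f \<in> E \<and> card (e \<inter> f) = j}"

lemma close_pairs_finite: "finite (close_pairs j)"
  by (rule finite_subset[of _ "E \<times> E"]) (use finE in \<open>auto simp: close_pairs_def\<close>)

text \<open>Choose \<open>e\<close>, one of at most 16 subsets of it as the intersection, and an
  edge \<open>f\<close> containing that subset, counted by \<open>deg_le\<close>.\<close>

lemma card_close_pairs:
  assumes j: "j \<le> 3"
  shows "real (card (close_pairs j)) \<le> 16 * D ^ 2 * n ^ (6 - j)"
proof -
  define I where "I = Sigma E (\<lambda>e. Sigma {S. S \<subseteq> e \<and> card S = j} (\<lambda>S. {f\<in>E. S \<subseteq> f}))"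
  have fS: "finite {S. S \<subseteq> e \<and> card S = j}" and cS: "card {S. S \<subseteq> e \<and> card S = j} \<le> 16" if "e \<in> E" for e
  proof -
    have "{S. S \<subseteq> e \<and> card S = j} \<subseteq> Pow e" by auto
    moreover have "finite (Pow e)" "card (Pow e) = 16"
      using E_fin[OF that] E_card[OF that] by (simp_all add: card_Pow)
    ultimately show "finite {S. S \<subseteq> e \<and> card S = j}" "card {S. S \<subseteq> e \<and> card S = j} \<le> 16"
      using card_mono[of "Pow e" "{S. S \<subseteq> e \<and> card S = j}"]
        finite_subset[of "{S. S \<subseteq> e \<and> card S = j}" "Pow e"] by linarith+
  qed
  have finI: "finite I" unfolding I_def using finE fS by auto
  have "close_pairs j \<subseteq> (\<lambda>(e, S, f). (e, f)) ` I"
  proof clarify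
    fix e f assume "(e, f) \<in> close_pairs j"
    hence "(e, e \<inter> f, f) \<in> I" by (auto simp: close_pairs_def I_def)
    thus "(e, f) \<in> (\<lambda>(e, S, f). (e, f)) ` I" by (rule rev_image_eqI) simp
  qed
  hence "card (close_pairs j) \<le> card ((\<lambda>(e, S, f). (e, f)) ` I)"
    using finI by (intro card_mono) auto
  also have "\<dots> \<le> card I" using finI by (rule card_image_le)
  finally have "real (card (close_pairs j)) \<le> real (card I)" by (rule of_nat_mono)
  also have "\<dots> \<le> real (card E) * (16 * (D * n ^ (3 - j)))"
    unfolding I_def
  proof (rule card_SigmaI_le)
    fix e assume e: "e \<in> E"
    show "finite (Sigma {S. S \<subseteq> e \<and> card S = j} (\<lambda>S. {f\<in>E. S \<subseteq> f}))"
      using fS[OF e] finE by auto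
    have "real (card (Sigma {S. S \<subseteq> e \<and> card S = j} (\<lambda>S. {f\<in>E. S \<subseteq> f}))) \<le>
      real (card {S. S \<subseteq> e \<and> card S = j}) * (D * n ^ (3 - j))"
    proof (rule card_SigmaI_le)
      fix S assume "S \<in> {S. S \<subseteq> e \<and> card S = j}"
      hence "S \<in> [V]\<^bsup>j\<^esup>"
        using E_sub[OF e] finite_subset[OF _ E_fin[OF e], of S] by (auto simp: nsets_def)
      thus "real (card {f\<in>E. S \<subseteq> f}) \<le> D * n ^ (3 - j)" using j by (intro deg_le)
    qed (use fS[OF e] finE in auto)
    also have "\<dots> \<le> 16 * (D * n ^ (3 - j))"
      using D cS[OF e] by (intro mult_right_mono) auto
    finally show "real (card (Sigma {S. S \<subseteq> e \<and> card S = j} (\<lambda>S. {f\<in>E. S \<subseteq> f}))) \<le> 16 * (D * n ^ (3 - j))" .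
  qed (rule finE)
  also have "\<dots> \<le> (D * n ^ 3) * (16 * (D * n ^ (3 - j)))"
    using D cardE by (intro mult_right_mono) auto
  also have "\<dots> = 16 * D ^ 2 * n ^ (3 + (3 - j))"
    by (simp add: power_add power2_eq_square)
  also have "3 + (3 - j) = 6 - j" using j by simp
  finally show ?thesis .
qed

text \<open>The last three components are an edge through \<open>x\<close>, a vertex \<open>z\<close> of it, and an edge through \<open>y\<close> and \<open>z\<close>.\<close>

definition triangles :: "('a set \<times> ('a \<times> 'a) \<times> 'a set \<times> 'a \<times> 'a set) set" where
  "triangles = Sigma E (\<lambda>e. Sigma (e \<times> e) (\<lambda>(x, y). Sigma {f\<in>E. x \<in> f}
     (\<lambda>f. Sigma (f - {y}) (\<lambda>z. {g\<in>E. y \<in> g \<and> z \<in> g}))))"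

lemma triangles_finite: "finite triangles"
  unfolding triangles_def using finE E_fin by (intro finite_SigmaI) auto

text \<open>The successive choices number at most D n^3 for \<open>e\<close>, 16 for
  \<open>(x, y)\<close>, D n^2 for \<open>f\<close>, 4 for \<open>z\<close> and D n for
  \<open>g\<close>. The last bound is \<open>deg2\<close>, which applies because \<open>z\<close>
  differs from \<open>y\<close>.\<close>

lemma card_triangles: "real (card triangles) \<le> 64 * D ^ 3 * n ^ 6"
proof -
  have "real (card triangles) \<le> real (card E) * (16 * ((D * n ^ 2) * (4 * (D * n))))"
    unfolding triangles_def
  proof (rule card_SigmaI_le)
    fix e assume e: "e \<in> E"
    have f1: "finite (SIGMA z:f - {y}. {g\<in>E. y \<in> g \<and> z \<in> g})" if "f \<in> E" for f y
      using finE E_fin that by auto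
    have f2: "finite (SIGMA f:{f \<in> E. x \<in> f}. SIGMA z:f - {y}. {g \<in> E. y \<in> g \<and> z \<in> g})" for x y
      using finE E_fin by (intro finite_SigmaI) auto
    show "finite (SIGMA (x, y):e \<times> e. SIGMA f:{f \<in> E. x \<in> f}. SIGMA z:f - {y}. {g \<in> E. y \<in> g \<and> z \<in> g})"
      using E_fin[OF e] f2 by (intro finite_SigmaI) auto
    have "real (card (SIGMA (x, y):e \<times> e. SIGMA f:{f \<in> E. x \<in> f}. SIGMA z:f - {y}. {g \<in> E. y \<in> g \<and> z \<in> g}))
      \<le> real (card (e \<times> e)) * ((D * n ^ 2) * (4 * (D * n)))"
    proof (rule card_SigmaI_le)
      fix xy assume xy: "xy \<in> e \<times> e"
      obtain x y where [simp]: "xy = (x, y)" by (cases xy)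
      have V: "x \<in> V" "y \<in> V" using xy E_sub[OF e] by auto
      show "finite (case xy of (x, y) \<Rightarrow> SIGMA f:{f \<in> E. x \<in> f}. SIGMA z:f - {y}. {g \<in> E. y \<in> g \<and> z \<in> g})"
        using f2 by simp
      have "real (card (SIGMA f:{f \<in> E. x \<in> f}. SIGMA z:f - {y}. {g \<in> E. y \<in> g \<and> z \<in> g})) \<le>
        real (card {f \<in> E. x \<in> f}) * (4 * (D * n))"
      proof (rule card_SigmaI_le)
        fix f assume f: "f \<in> {f \<in> E. x \<in> f}"
        have fE: "f \<in> E" using f by simp
        have "real (card (SIGMA z:f - {y}. {g \<in> E. y \<in> g \<and> z \<in> g})) \<le> real (card (f - {y})) * (D * n)"
          using V E_fin[OF fE] E_sub[OF fE] finE by (intro card_SigmaI_le deg2) auto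
        also have "\<dots> \<le> 4 * (D * n)"
          using D E_card[OF fE] E_fin[OF fE] card_mono[of f "f - {y}"] by (intro mult_right_mono) auto
        finally show "real (card (SIGMA z:f - {y}. {g \<in> E. y \<in> g \<and> z \<in> g})) \<le> 4 * (D * n)" .
        show "finite (SIGMA z:f - {y}. {g \<in> E. y \<in> g \<and> z \<in> g})" using f1 fE by simp
      qed (use finE in simp)
      also have "\<dots> \<le> (D * n ^ 2) * (4 * (D * n))"
        using D deg1 V by (intro mult_right_mono) auto
      finally show "real (card (case xy of (x, y) \<Rightarrow> SIGMA f:{f \<in> E. x \<in> f}. SIGMA z:f - {y}. {g \<in> E. y \<in> g \<and> z \<in> g}))
         \<le> (D * n ^ 2) * (4 * (D * n))" by simp
    qed (use E_fin[OF e] in simp)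
    also have "real (card (e \<times> e)) = 16" using E_card[OF e] by (simp add: card_cartesian_product)
    finally show "real (card (SIGMA (x, y):e \<times> e. SIGMA f:{f \<in> E. x \<in> f}. SIGMA z:f - {y}. {g \<in> E. y \<in> g \<and> z \<in> g}))
      \<le> 16 * ((D * n ^ 2) * (4 * (D * n)))" .
  qed (rule finE)
  also have "\<dots> \<le> (D * n ^ 3) * (16 * ((D * n ^ 2) * (4 * (D * n))))"
    using D cardE by (intro mult_right_mono) auto
  also have "\<dots> = 64 * D ^ 3 * n ^ 6"
    by (simp add: power_numeral_reduce)
  finally show ?thesis .
qed

text \<open>Double counting: a conflict of \<open>v\<close> with \<open>W\<close> is an edge
  together with a triple of \<open>W\<close> inside it. There are at most |W|^3 triples, each in at
  most \<open>D\<close> edges.\<close>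

lemma sum_conflicts_le:
  assumes W: "W \<subseteq> V"
  shows "(\<Sum>v\<in>V - W. real (conflicts E W v)) \<le> D * real (card W) ^ 3"
proof -
  have finW: "finite W" using W finV finite_subset by auto
  define J where "J = Sigma (V - W) (\<lambda>v. {e\<in>E. v \<in> e \<and> e - {v} \<subseteq> W})"
  define I where "I = Sigma ([W]\<^bsup>3\<^esup>) (\<lambda>S. {e\<in>E. S \<subseteq> e})"
  have finI: "finite I" unfolding I_def using finE finW by (intro finite_SigmaI) (auto simp: finite_imp_finite_nsets)
  have "inj_on (\<lambda>(v, e). (e - {v}, e)) J"
    by (intro inj_onI) (auto simp: J_def)
  moreover have "(\<lambda>(v, e). (e - {v}, e)) ` J \<subseteq> I"
    using E_card E_fin by (auto simp: J_def I_def nsets_def)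
  ultimately have "card J \<le> card I" using finI by (rule card_inj_on_le)
  have "(\<Sum>v\<in>V - W. real (conflicts E W v)) = real (card J)"
    unfolding J_def conflicts_def using finV finE by simp
  also have "\<dots> \<le> real (card I)" using \<open>card J \<le> card I\<close> by simp
  also have "\<dots> \<le> real (card ([W]\<^bsup>3\<^esup>)) * D"
    unfolding I_def using finW finE W nsets_mono[OF W]
    by (intro card_SigmaI_le deg3) (auto intro: finite_imp_finite_nsets)
  also have "card ([W]\<^bsup>3\<^esup>) = card W choose 3" by (rule card_nsets)
  also have "real (card W choose 3) * D \<le> real (card W ^ 3) * D"
    using D binomial_le_power[of "card W" 3] by (intro mult_right_mono of_nat_mono) auto
  finally show ?thesis by (simp add: mult.commute)
qed

text \<open>After sampling with probability \<open>q / n\<close> and deleting obstructions, an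
  independent set from \<open>ex_independent_many_conflicts\<close> with fewer than \<open>r\<close>
  vertices would have more truncated conflicts than the sample permits. Hypothesis
  \<open>small\<close> makes the expected cost of a sample less than 1, and \<open>large\<close>
  makes the contribution of the fewer than \<open>r\<close> chosen vertices negligible.\<close>

lemma ex_independent:
  fixes r K :: nat and q :: real
  defines "a \<equiv> D / n"
  assumes q: "1 \<le> q" "q \<le> n" and K: "1 \<le> K"
    and small: "exp (- (q / 4)) + 72 / q * (a * q ^ 3 + 16 * a ^ 2 * q ^ 6 + 16 * a ^ 2 * q ^ 5 + 64 * a ^ 3 * q ^ 9)
        + real r * q ^ r * exp (2 * q * real r ^ 3 * a / real K - q / 256) < 1"
    and large: "256 * 2 ^ K * real r < q"
  shows "\<exists>H\<in>[V]\<^bsup>r\<^esup>. indep E H \<and> indep F H"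
proof (rule ccontr)
  assume neg: "\<not> ?thesis"
  define p where "p = q / n"
  have n: "0 < n" using q by linarith
  have p: "0 \<le> p" "p \<le> 1" "n * p = q" using q n by (auto simp: p_def)
  have a: "0 \<le> a" using D by (simp add: a_def)
  define P2 where "P2 = (\<lambda>(e, f). e \<union> f) ` close_pairs 2"
  define P3 where "P3 = (\<lambda>(e, f). e \<union> f) ` close_pairs 3"
  \<comment> \<open>A linear triangle covers 12 - 3 = 9 vertices. The filter gives all members this
    size, as \<open>sample_mean_card\<close> requires.\<close>
  define P4 where "P4 = {C\<in>(\<lambda>(e, (x, y), f, z, g). e \<union> f \<union> g) ` triangles. card C = 9}"
  have un: "card (e \<union> f) = 8 - card (e \<inter> f)" if "e \<in> E" "f \<in> E" for e f
    using card_Un_Int[OF E_fin[OF that(1)] E_fin[OF that(2)]] E_card that by simp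
  have F3: "C \<subseteq> V \<and> card C = 3" if "C \<in> F" for C using that F by (auto simp: nsets_def)
  have P2: "C \<subseteq> V \<and> card C = 6" if "C \<in> P2" for C
    using that E_sub by (auto simp: P2_def close_pairs_def un)
  have P3: "C \<subseteq> V \<and> card C = 5" if "C \<in> P3" for C
    using that E_sub by (auto simp: P3_def close_pairs_def un)
  have P4: "C \<subseteq> V \<and> card C = 9" if C: "C \<in> P4" for C
  proof -
    have sub: "e \<union> f \<union> g \<subseteq> V" if "(e, (x, y), f, z, g) \<in> triangles" for e x y f z g
      using that E_sub by (auto simp: triangles_def)
    obtain e x y f z g where "C = e \<union> f \<union> g" "(e, (x, y), f, z, g) \<in> triangles" "card C = 9"
      using C by (auto simp: P4_def)
    thus ?thesis using sub by blast
  qed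
  have finP: "finite P2" "finite P3" "finite P4"
    unfolding P2_def P3_def P4_def using close_pairs_finite triangles_finite by auto
  have cP2: "real (card P2) \<le> 16 * D ^ 2 * n ^ 4"
    using card_close_pairs[of 2] card_image_le[OF close_pairs_finite, of "\<lambda>(e, f). e \<union> f" 2]
    unfolding P2_def by simp
  have cP3: "real (card P3) \<le> 16 * D ^ 2 * n ^ 3"
    using card_close_pairs[of 3] card_image_le[OF close_pairs_finite, of "\<lambda>(e, f). e \<union> f" 3]
    unfolding P3_def by simp
  have "card P4 \<le> card ((\<lambda>(e, (x, y), f, z, g). e \<union> f \<union> g) ` triangles)"
    unfolding P4_def using triangles_finite by (intro card_mono) auto
  also have "\<dots> \<le> card triangles" by (rule card_image_le[OF triangles_finite])
  finally have cP4: "real (card P4) \<le> 64 * D ^ 3 * n ^ 6" using card_triangles by linarith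
  define N where "N A = real (card {C\<in>F. C \<subseteq> A}) + real (card {C\<in>P2. C \<subseteq> A})
    + real (card {C\<in>P3. C \<subseteq> A}) + real (card {C\<in>P4. C \<subseteq> A})" for A
  have meanN: "sample_mean p V N \<le> a * q ^ 3 + 16 * a ^ 2 * q ^ 6 + 16 * a ^ 2 * q ^ 5 + 64 * a ^ 3 * q ^ 9"
  proof -
    have "sample_mean p V N = real (card F) * p ^ 3 + real (card P2) * p ^ 6 + real (card P3) * p ^ 5 + real (card P4) * p ^ 9"
      unfolding N_def sample_mean_add
      by (simp only: sample_mean_card[OF finV F3] sample_mean_card[OF finV P2]
        sample_mean_card[OF finV P3] sample_mean_card[OF finV P4])
    also have "\<dots> \<le> D * n ^ 2 * p ^ 3 + 16 * D ^ 2 * n ^ 4 * p ^ 6 + 16 * D ^ 2 * n ^ 3 * p ^ 5 + 64 * D ^ 3 * n ^ 6 * p ^ 9"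
      using cardF cP2 cP3 cP4 p by (intro add_mono mult_right_mono) auto
    also have "\<dots> = a * q ^ 3 + 16 * a ^ 2 * q ^ 6 + 16 * a ^ 2 * q ^ 5 + 64 * a ^ 3 * q ^ 9"
    proof -
      \<comment> \<open>After this substitution \<open>n\<close> and \<open>p\<close> occur with
        equal exponents in every term, so they combine to powers of \<open>q\<close>.\<close>
      have "D = a * n" using n by (simp add: a_def)
      thus ?thesis by (simp add: p(3)[symmetric] power_mult_distrib power_numeral_reduce)
    qed
    finally show ?thesis .
  qed
  \<comment> \<open>Truncation at \<open>K\<close> and division by \<open>K\<close> bring the
    conflicts into [0, 1], as \<open>sample_mean_exp_le\<close> demands.\<close>
  define y where "y W v = real (min (conflicts E W v) K) / real K" for W v
  have y: "0 \<le> y W v" "y W v \<le> 1" for W v using K by (auto simp: y_def)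
  define S where "S = {W. W \<subseteq> V \<and> card W < r}"
  \<comment> \<open>Only sets \<open>W\<close> inside the sample count. The resulting weight p^|W|
    is what keeps the sum over all \<open>W\<close> in \<open>S\<close> affordable.\<close>
  define Z where "Z W A = of_bool (W \<subseteq> A) * exp (\<Sum>v\<in>A - W. y W v)" for W A
  have meanZ: "sample_mean p V (Z W) \<le> p ^ card W * exp (2 * q * real r ^ 3 * a / real K)" if "W \<in> S" for W
  proof -
    have W: "W \<subseteq> V" "card W \<le> r" using that by (auto simp: S_def)
    have "(\<Sum>v\<in>V - W. y W v) \<le> (\<Sum>v\<in>V - W. real (conflicts E W v) / real K)"
      unfolding y_def by (intro sum_mono divide_right_mono) auto
    also have "\<dots> = (\<Sum>v\<in>V - W. real (conflicts E W v)) / real K" by (simp add: sum_divide_distrib)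
    also have "\<dots> \<le> D * real (card W) ^ 3 / real K"
      using sum_conflicts_le W by (intro divide_right_mono) auto
    also have "\<dots> \<le> D * real r ^ 3 / real K"
      using W D by (intro divide_right_mono mult_left_mono power_mono) auto
    finally have "2 * p * (\<Sum>v\<in>V - W. y W v) \<le> 2 * p * (D * real r ^ 3 / real K)"
      using p by (intro mult_left_mono) auto
    also have "\<dots> = 2 * q * real r ^ 3 * a / real K" by (simp add: p_def a_def)
    finally have le: "exp (2 * p * (\<Sum>v\<in>V - W. y W v)) \<le> exp (2 * q * real r ^ 3 * a / real K)" by simp
    have "sample_mean p V (Z W) \<le> p ^ card W * exp (2 * p * (\<Sum>v\<in>V - W. y W v))"
      unfolding Z_def using finV W p y by (intro sample_mean_exp_le) auto
    also have "\<dots> \<le> p ^ card W * exp (2 * q * real r ^ 3 * a / real K)"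
      using le p by (intro mult_left_mono) auto
    finally show ?thesis .
  qed
  text \<open>The three terms penalize a small sample, many deleted vertices, and many conflicts.\<close>
  define cost where "cost A = exp (q / 4) * exp (- real (card A)) + 72 / q * N A
    + exp (- (q / 256)) * (\<Sum>W\<in>S. Z W A)" for A
  have "sample_mean p V cost = exp (q / 4) * sample_mean p V (\<lambda>A. exp (- real (card A)))
      + 72 / q * sample_mean p V N + exp (- (q / 256)) * (\<Sum>W\<in>S. sample_mean p V (Z W))"
    unfolding cost_def sample_mean_add sample_mean_cmult sample_mean_sum ..
  also have "\<dots> \<le> exp (q / 4) * exp (- (q / 2))
      + 72 / q * (a * q ^ 3 + 16 * a ^ 2 * q ^ 6 + 16 * a ^ 2 * q ^ 5 + 64 * a ^ 3 * q ^ 9)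
      + exp (- (q / 256)) * (real r * q ^ r * exp (2 * q * real r ^ 3 * a / real K))"
  proof (intro add_mono mult_left_mono)
    show "sample_mean p V (\<lambda>A. exp (- real (card A))) \<le> exp (- (q / 2))"
      using sample_mean_exp_neg_card_le[OF finV p(1,2)] p(3) by (simp add: mult.commute)
    have "(\<Sum>W\<in>S. sample_mean p V (Z W)) \<le> (\<Sum>W\<in>S. p ^ card W * exp (2 * q * real r ^ 3 * a / real K))"
      by (intro sum_mono meanZ)
    also have "\<dots> = (\<Sum>W\<in>S. p ^ card W) * exp (2 * q * real r ^ 3 * a / real K)"
      by (simp add: sum_distrib_right)
    also have "\<dots> \<le> real r * q ^ r * exp (2 * q * real r ^ 3 * a / real K)"
      using sum_pow_card_le[OF finV p(1), of r] p(3) q unfolding S_def by (intro mult_right_mono) auto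
    finally show "(\<Sum>W\<in>S. sample_mean p V (Z W)) \<le> real r * q ^ r * exp (2 * q * real r ^ 3 * a / real K)" .
  qed (use meanN q in auto)
  also have "\<dots> = exp (- (q / 4)) + 72 / q * (a * q ^ 3 + 16 * a ^ 2 * q ^ 6 + 16 * a ^ 2 * q ^ 5 + 64 * a ^ 3 * q ^ 9)
        + real r * q ^ r * exp (2 * q * real r ^ 3 * a / real K - q / 256)"
  proof -
    have "exp (q / 4) * exp (- (q / 2)) = exp (- (q / 4))" by (simp flip: exp_add)
    moreover have "exp (- (q / 256)) * (real r * q ^ r * exp (2 * q * real r ^ 3 * a / real K)) =
        real r * q ^ r * exp (2 * q * real r ^ 3 * a / real K - q / 256)"
      by (simp only: diff_conv_add_uminus exp_add mult_ac)
    ultimately show ?thesis by (simp only:)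
  qed
  finally have "sample_mean p V cost < 1" using small by linarith
  then obtain A where A: "A \<subseteq> V" "cost A < 1"
    using sample_mean_lt_imp_ex[OF finV p(1,2)] by blast
  have finA: "finite A" using A finV finite_subset by blast
  have N0: "0 \<le> N A" by (simp add: N_def)
  have Z0: "0 \<le> Z W A" for W by (simp add: Z_def)
  have sZ0: "0 \<le> (\<Sum>W\<in>S. Z W A)" by (intro sum_nonneg Z0)
  have pos: "0 \<le> exp (q / 4) * exp (- real (card A))" "0 \<le> 72 / q * N A" "0 \<le> exp (- (q / 256)) * (\<Sum>W\<in>S. Z W A)"
    using N0 sZ0 q by auto
  have "exp (q / 4) * exp (- real (card A)) < 1" using A(2) pos unfolding cost_def by linarith
  hence "exp (q / 4 - real (card A)) < 1" by (simp only: diff_conv_add_uminus exp_add)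
  hence cardA: "q / 4 < real (card A)" by simp
  have "72 / q * N A < 1" using A(2) pos unfolding cost_def by linarith
  \<comment> \<open>Fewer than q / 72 sets are to be deleted, each of at most 9 vertices.\<close>
  hence NA: "9 * N A < q / 8" using q by (simp add: field_simps)
  \<comment> \<open>All summands \<open>Z W A\<close> are nonnegative, so the one sample
    \<open>A\<close> serves every \<open>W\<close> at once. This matters because \<open>W\<close> is
    chosen later and depends on \<open>A\<close>.\<close>
  have yA: "(\<Sum>v\<in>A - W. y W v) < q / 256" if W: "W \<subseteq> A" "card W < r" for W
  proof -
    have "finite S" unfolding S_def by (rule finite_subset[of _ "Pow V"]) (use finV in auto)
    moreover have "W \<in> S" using W A by (auto simp: S_def)
    ultimately have "Z W A \<le> (\<Sum>W\<in>S. Z W A)" using Z0 by (intro member_le_sum) auto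
    hence "exp (- (q / 256)) * Z W A \<le> exp (- (q / 256)) * (\<Sum>W\<in>S. Z W A)"
      by (intro mult_left_mono) auto
    hence "exp (- (q / 256)) * Z W A < 1" using A(2) pos unfolding cost_def by linarith
    moreover have "Z W A = exp (\<Sum>v\<in>A - W. y W v)" using W(1) by (simp add: Z_def)
    hence "exp ((\<Sum>v\<in>A - W. y W v) - q / 256) = exp (- (q / 256)) * Z W A"
      by (simp only: diff_conv_add_uminus exp_add mult.commute)
    ultimately have "exp ((\<Sum>v\<in>A - W. y W v) - q / 256) < 1" by simp
    thus ?thesis by simp
  qed
  define X where "X = {C \<in> F \<union> P2 \<union> P3 \<union> P4. C \<subseteq> A}"
  define U where "U = A - \<Union>X"
  have finX: "finite X" unfolding X_def using finF finP by auto
  have "X = {C\<in>F. C \<subseteq> A} \<union> {C\<in>P2. C \<subseteq> A} \<union> {C\<in>P3. C \<subseteq> A} \<union> {C\<in>P4. C \<subseteq> A}"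
    unfolding X_def by auto
  moreover have "card (a \<union> b \<union> c \<union> d) \<le> card a + card b + card c + card d" for a b c d :: "'a set set"
    using card_Un_le[of "a \<union> b \<union> c" d] card_Un_le[of "a \<union> b" c] card_Un_le[of a b] by linarith
  ultimately have "card X \<le> card {C\<in>F. C \<subseteq> A} + card {C\<in>P2. C \<subseteq> A} + card {C\<in>P3. C \<subseteq> A} + card {C\<in>P4. C \<subseteq> A}"
    by (simp only:)
  hence cX: "real (card X) \<le> N A" unfolding N_def by linarith
  have "card (\<Union>X) \<le> (\<Sum>C\<in>X. card C)" by (rule card_Union_le_sum_card)
  also have "\<dots> \<le> (\<Sum>C\<in>X. 9)"
  proof (rule sum_mono)
    fix C assume "C \<in> X"
    thus "card C \<le> 9" using F3[of C] P2[of C] P3[of C] P4[of C] by (auto simp: X_def)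
  qed
  finally have "real (card (\<Union>X)) \<le> 9 * N A" using cX by simp
  moreover have "real (card A) \<le> real (card U) + real (card (\<Union>X))"
  proof -
    have "\<Union>X \<subseteq> A" by (auto simp: X_def)
    hence "finite (\<Union>X)" using finA by (rule finite_subset)
    hence "card A \<le> card (U \<union> \<Union>X)" using finA by (intro card_mono) (auto simp: U_def)
    also have "\<dots> \<le> card U + card (\<Union>X)" by (rule card_Un_le)
    finally show ?thesis by linarith
  qed
  ultimately have cardU: "q / 8 < real (card U)" using cardA NA by linarith
  have finU: "finite U" and UA: "U \<subseteq> A" using finA by (auto simp: U_def)
  \<comment> \<open>All points of an obstruction inside \<open>A\<close> are deleted, so no point of
    it survives in \<open>U\<close>.\<close>
  have avoid: False if "C \<in> F \<union> P2 \<union> P3 \<union> P4" "C \<subseteq> A" "x \<in> C" "x \<in> U" for C x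
    using that by (auto simp: U_def X_def)
  \<comment> \<open>Distinct edges sharing 2 or 3 points have their union in \<open>P2\<close> or
    \<open>P3\<close>.\<close>
  have lin: "card (e \<inter> f) < 2" if "e \<in> E" "f \<in> E" "e \<subseteq> U" "f \<subseteq> U" "e \<noteq> f" for e f
  proof (rule ccontr)
    assume "\<not> ?thesis"
    hence ge: "2 \<le> card (e \<inter> f)" by simp
    have "\<not> e \<subseteq> f"
      using card_subset_eq[OF E_fin[OF that(2)], of e] E_card[OF that(1)] E_card[OF that(2)] that(5) by auto
    hence "e \<inter> f \<subset> e" by blast
    hence "card (e \<inter> f) < 4" using psubset_card_mono[OF E_fin[OF that(1)]] E_card[OF that(1)] by auto
    hence "card (e \<inter> f) = 2 \<or> card (e \<inter> f) = 3" using ge by linarith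
    hence "e \<union> f \<in> P2 \<union> P3"
      using that unfolding P2_def P3_def close_pairs_def by force
    moreover obtain x where "x \<in> e"
      using E_card[OF \<open>e \<in> E\<close>] by (metis all_not_in_conv card.empty zero_neq_numeral)
    ultimately show False using avoid[of "e \<union> f" x] that UA by blast
  qed
  have lin': "x = y" if "e \<in> E" "f \<in> E" "e \<subseteq> U" "f \<subseteq> U" "e \<noteq> f" "x \<in> e" "x \<in> f" "y \<in> e" "y \<in> f" for e f x y
  proof (rule ccontr)
    assume "x \<noteq> y"
    hence "card {x, y} = 2" by simp
    moreover have "card {x, y} \<le> card (e \<inter> f)" using that E_fin by (intro card_mono) auto
    ultimately show False using lin[of e f] that by linarith
  qed
  \<comment> \<open>If \<open>x\<close> and \<open>y\<close> differed, linearity would make the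
    three edges meet pairwise in the single points \<open>x\<close>, \<open>y\<close> and
    \<open>v\<close>; their union would have 4 + 3 + 2 = 9 points and belong to
    \<open>P4\<close>.\<close>
  have unc: "x = y" if "e \<in> E" "f \<in> E" "g \<in> E" "e \<subseteq> U" "f \<subseteq> U" "g \<subseteq> U"
        "v \<notin> e" "v \<in> f" "v \<in> g" "x \<in> e" "x \<in> f" "y \<in> e" "y \<in> g" for v e f g x y
  proof (rule ccontr)
    assume xy: "x \<noteq> y"
    have ne: "e \<noteq> f" "e \<noteq> g" using that by auto
    have fg: "f \<noteq> g" using lin'[of e f x y] that ne xy by auto
    have fin: "finite e" "finite f" "finite g" using that E_fin by auto
    have ef: "e \<inter> f = {x}" using lin'[of e f _ x] that ne by blast
    have eg: "e \<inter> g = {y}" using lin'[of e g _ y] that ne by blast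
    have fg': "f \<inter> g = {v}" using lin'[of f g _ v] that fg by blast
    have "(e \<union> f) \<inter> g = {y, v}" using eg fg' by blast
    moreover have "y \<noteq> v" using that by auto
    ultimately have "card ((e \<union> f) \<inter> g) = 2" by simp
    moreover have "card (e \<union> f) = 7" using un[of e f] that ef by simp
    ultimately have "card (e \<union> f \<union> g) = 9"
      using card_Un_Int[of "e \<union> f" g] fin E_card[OF that(3)] by simp
    moreover have "(e, (x, y), f, v, g) \<in> triangles"
      using that \<open>y \<noteq> v\<close> by (auto simp: triangles_def)
    ultimately have "e \<union> f \<union> g \<in> P4"
      unfolding P4_def by (auto intro!: rev_image_eqI)
    thus False using avoid[of "e \<union> f \<union> g" x] that UA by blast
  qed
  have "\<exists>W\<subseteq>U. indep E W \<and> real (card U) * real K / 16 \<le>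
      real K * 2 ^ K * real (card W) + (\<Sum>v\<in>U - W. real (min (conflicts E W v) K))"
    by (rule ex_independent_many_conflicts[OF finU]) (fact E_card, fact unc)
  then obtain W where W: "W \<subseteq> U" "indep E W" and
    many: "real (card U) * real K / 16 \<le>
      real K * 2 ^ K * real (card W) + (\<Sum>v\<in>U - W. real (min (conflicts E W v) K))"
    by blast
  \<comment> \<open>Otherwise an \<open>r\<close>-subset of \<open>W\<close> would contradict
    \<open>neg\<close>; it is independent for \<open>F\<close> because \<open>U\<close> meets no
    member of \<open>F\<close> inside \<open>A\<close>.\<close>
  have Wr: "card W < r"
  proof (rule ccontr)
    assume "\<not> ?thesis"
    then obtain H where H: "H \<subseteq> W" "card H = r" "finite H"
      by (meson obtain_subset_with_card_n not_less)
    have "indep F H"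
      unfolding indep_def
    proof (intro ballI notI)
      fix C assume C: "C \<in> F" "C \<subseteq> H"
      then obtain x where "x \<in> C"
        using F3[OF C(1)] by (metis all_not_in_conv card.empty zero_neq_numeral)
      thus False using avoid[of C x] C H W UA by blast
    qed
    moreover have "indep E H" using W(2) H(1) by (rule indep_subset)
    moreover have "H \<in> [V]\<^bsup>r\<^esup>" using H W UA A by (auto simp: nsets_def)
    ultimately show False using neg by blast
  qed
  have "(\<Sum>v\<in>U - W. real (min (conflicts E W v) K)) = real K * (\<Sum>v\<in>U - W. y W v)"
    using K by (simp add: y_def sum_distrib_left)
  also have "\<dots> \<le> real K * (\<Sum>v\<in>A - W. y W v)"
    using finA UA y by (intro mult_left_mono sum_mono2) auto
  also have "\<dots> \<le> real K * (q / 256)"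
    using yA[OF subset_trans[OF W(1) UA] Wr] by (intro mult_left_mono) auto
  finally have "(\<Sum>v\<in>U - W. real (min (conflicts E W v) K)) \<le> real K * (q / 256)" .
  moreover have "real K * 2 ^ K * real (card W) \<le> real K * 2 ^ K * real r"
    using Wr by (intro mult_left_mono) auto
  moreover have "real K * (q / 128) \<le> real K * (real (card U) / 16)"
    using cardU by (intro mult_left_mono) auto
  \<comment> \<open>More than q / 8 survivors force q / 128 per unit of \<open>K\<close>, twice the
    q / 256 that \<open>yA\<close> allows; the remaining q / 256 exceeds 2^K r by
    \<open>large\<close>.\<close>
  ultimately have "real K * (q / 128) \<le> real K * (2 ^ K * real r + q / 256)"
    using many by (simp add: algebra_simps)
  hence "q / 128 \<le> 2 ^ K * real r + q / 256" using K by simp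
  thus False using large by simp
qed

end

section \<open>Choice of parameters\<close>

text \<open>The numerical hypotheses of \<open>ex_independent\<close>, freed from the hypergraph:
  \<open>a\<close> stands for its density \<open>D / n\<close>, and the upper bound on
  \<open>q\<close> will yield \<open>q <= n\<close>.\<close>

definition admissible :: "nat \<Rightarrow> nat \<Rightarrow> real \<Rightarrow> bool" where
  "admissible r K q \<longleftrightarrow> 1 \<le> K \<and> 1 \<le> q \<and> q \<le> 32768 * real r ^ 3 / ln (real r) \<and>
     256 * 2 ^ K * real r < q \<and>
     (\<forall>a. 0 \<le> a \<longrightarrow> a \<le> ln (real r) / (32768 * real r ^ 3) \<longrightarrow>
        exp (- (q / 4)) + 72 / q * (a * q ^ 3 + 16 * a ^ 2 * q ^ 6 + 16 * a ^ 2 * q ^ 5 + 64 * a ^ 3 * q ^ 9)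
        + real r * q ^ r * exp (2 * q * real r ^ 3 * a / real K - q / 256) < 1)"

text \<open>Take q = r^(17/16), so that q beats r ln r in the union bound, and K of order ln r. The
  deletion terms vanish: up to logarithms a is r^-3, and the largest term a^3 q^8 is
  r^(-1/2).\<close>

lemma eventually_admissible: "eventually (\<lambda>r. \<exists>K q. admissible r K q) sequentially"
proof -
  define q :: "nat \<Rightarrow> real" where "q r = real r powr (17/16)" for r
  define b :: "nat \<Rightarrow> real" where "b r = ln (real r) / (32768 * real r ^ 3)" for r
  define K where "K r = nat \<lfloor>ln (real r) / 16\<rfloor>" for r :: nat
  have ev1: "eventually (\<lambda>r::nat. 1 \<le> ln (real r) / 32) sequentially" by real_asymp
  have ev2: "eventually (\<lambda>r. q r \<le> 32768 * real r ^ 3 / ln (real r)) sequentially"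
    unfolding q_def by real_asymp
  have ev3: "eventually (\<lambda>r. 256 * real r powr (3/64) * real r < q r) sequentially"
    unfolding q_def by real_asymp
  have ev4: "eventually (\<lambda>r. exp (- (q r / 4)) < 1/8) sequentially"
    unfolding q_def by real_asymp
  have ev5: "eventually (\<lambda>r. 72 / q r * (b r * q r ^ 3) < 1/8) sequentially"
    unfolding q_def b_def by real_asymp
  have ev6: "eventually (\<lambda>r. 72 / q r * (16 * b r ^ 2 * q r ^ 6) < 1/8) sequentially"
    unfolding q_def b_def by real_asymp
  have ev7: "eventually (\<lambda>r. 72 / q r * (16 * b r ^ 2 * q r ^ 5) < 1/8) sequentially"
    unfolding q_def b_def by real_asymp
  have ev8: "eventually (\<lambda>r. 72 / q r * (64 * b r ^ 3 * q r ^ 9) < 1/8) sequentially"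
    unfolding q_def b_def by real_asymp
  have ev9: "eventually (\<lambda>r. real r * exp (17 / 16 * real r * ln (real r) - q r / 512) < 1/8) sequentially"
    unfolding q_def by real_asymp
  have "eventually (\<lambda>r. admissible r (K r) (q r)) sequentially"
    using ev1 ev2 ev3 ev4 ev5 ev6 ev7 ev8 ev9
  proof eventually_elim
    case (elim r)
    have r: "1 < real r" using elim(1) by (cases "r \<le> 1") (auto simp: le_Suc_eq)
    have q1: "1 \<le> q r" using r by (simp add: q_def ge_one_powr_ge_zero)
    \<comment> \<open>Since ln r / 16 >= 2, rounding down loses at most half.\<close>
    have Ku: "real (K r) \<le> ln (real r) / 16" and Kl: "ln (real r) / 32 \<le> real (K r)"
      using elim(1) unfolding K_def by linarith+
    have K1: "1 \<le> K r" using Kl elim(1) by linarith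
    \<comment> \<open>This makes 2^K at most r^(3/64), and 1 + 3/64 is below the exponent 17/16 of
      \<open>q\<close>.\<close>
    have "(2::real) \<le> exp (3/4)"
      using exp_lower_Taylor_quadratic[of "3/4"] by (simp add: power2_eq_square)
    hence "(2::real) ^ K r \<le> exp (3/4) ^ K r" by (intro power_mono) auto
    also have "\<dots> = exp (3/4 * real (K r))" by (simp add: mult.commute flip: exp_of_nat_mult)
    also have "\<dots> \<le> exp (3/64 * ln (real r))" using Ku by simp
    also have "\<dots> = real r powr (3/64)" using r by (simp add: powr_def)
    finally have "256 * 2 ^ K r * real r \<le> 256 * real r powr (3/64) * real r"
      using r by (intro mult_right_mono mult_left_mono) auto
    hence large: "256 * 2 ^ K r * real r < q r" using elim(3) by linarith
    have small: "exp (- (q r / 4)) + 72 / q r * (a * q r ^ 3 + 16 * a ^ 2 * q r ^ 6 + 16 * a ^ 2 * q r ^ 5 + 64 * a ^ 3 * q r ^ 9)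
        + real r * q r ^ r * exp (2 * q r * real r ^ 3 * a / real (K r) - q r / 256) < 1"
      if a: "0 \<le> a" "a \<le> b r" for a
    proof -
      have "72 / q r * (a * q r ^ 3 + 16 * a ^ 2 * q r ^ 6 + 16 * a ^ 2 * q r ^ 5 + 64 * a ^ 3 * q r ^ 9)
        \<le> 72 / q r * (b r * q r ^ 3 + 16 * b r ^ 2 * q r ^ 6 + 16 * b r ^ 2 * q r ^ 5 + 64 * b r ^ 3 * q r ^ 9)"
        using a q1 by (intro mult_left_mono add_mono mult_right_mono power_mono) auto
      moreover have "\<dots> < 4 / 8" using elim(5,6,7,8) by (simp add: distrib_left)
      moreover have "real r * q r ^ r * exp (2 * q r * real r ^ 3 * a / real (K r) - q r / 256) < 1/8"
      proof -
        have "2 * q r * real r ^ 3 * a / real (K r) \<le> 2 * q r * real r ^ 3 * b r / real (K r)"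
          using a q1 by (intro divide_right_mono mult_left_mono) auto
        also have "\<dots> = 2 * q r * (ln (real r) / 32768) / real (K r)"
          using r by (simp add: b_def)
        \<comment> \<open>The constant 32768 = 2^15 is chosen so that this equals q / 512, half of
          the available q / 256.\<close>
        also have "\<dots> \<le> 2 * q r * (32 * real (K r) / 32768) / real (K r)"
          using Kl q1 by (intro divide_right_mono mult_left_mono) auto
        also have "\<dots> = q r / 512" using K1 by simp
        finally have "exp (2 * q r * real r ^ 3 * a / real (K r) - q r / 256) \<le> exp (- (q r / 512))" by simp
        hence le: "real r * q r ^ r * exp (2 * q r * real r ^ 3 * a / real (K r) - q r / 256)
          \<le> real r * q r ^ r * exp (- (q r / 512))"
          using q1 by (intro mult_left_mono) auto
        have "q r = exp (17 / 16 * ln (real r))" using r by (simp add: q_def powr_def)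
        hence "q r ^ r = exp (17 / 16 * real r * ln (real r))"
          by (simp add: mult_ac flip: exp_of_nat_mult)
        hence "real r * q r ^ r * exp (- (q r / 512)) = real r * exp (17 / 16 * real r * ln (real r) - q r / 512)"
          by (simp only: diff_conv_add_uminus exp_add mult.assoc)
        thus ?thesis using le elim(9) by linarith
      qed
      ultimately show ?thesis using elim(4) by linarith
    qed
    show ?case unfolding admissible_def using K1 q1 elim(2) large small by (auto simp: b_def)
  qed
  thus ?thesis by (rule eventually_mono) blast
qed

section \<open>Colorings\<close>

lemma rainbow_clique_subset: "rainbow_clique \<chi> H \<Longrightarrow> S \<subseteq> H \<Longrightarrow> rainbow_clique \<chi> S"
  unfolding rainbow_clique_def using nsets_mono inj_on_subset by metis

text \<open>Two distinct edges either share one vertex or are disjoint, so equal colors have just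
  these two shapes, living on 3-sets and 4-sets.\<close>

lemma rainbow_clique_iff:
  "rainbow_clique \<chi> H \<longleftrightarrow>
     (\<forall>a\<in>H. \<forall>b\<in>H. \<forall>c\<in>H. distinct [a, b, c] \<longrightarrow> \<chi> {a, b} \<noteq> \<chi> {a, c}) \<and>
     (\<forall>a\<in>H. \<forall>b\<in>H. \<forall>c\<in>H. \<forall>d\<in>H. distinct [a, b, c, d] \<longrightarrow> \<chi> {a, b} \<noteq> \<chi> {c, d})"
  (is "_ \<longleftrightarrow> ?R")
proof
  assume rb: "rainbow_clique \<chi> H"
  have eq: "{a, b} = {c, d}" if "a \<in> H" "b \<in> H" "c \<in> H" "d \<in> H" "a \<noteq> b" "c \<noteq> d" "\<chi> {a, b} = \<chi> {c, d}" for a b c d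
    using rb that unfolding rainbow_clique_def by (auto dest!: inj_onD simp: nsets_2_eq)
  show ?R
    using eq by (auto simp: doubleton_eq_iff)
next
  assume R: ?R
  show "rainbow_clique \<chi> H"
    unfolding rainbow_clique_def
  proof (rule inj_onI)
    fix e f assume "e \<in> [H]\<^bsup>2\<^esup>" "f \<in> [H]\<^bsup>2\<^esup>" and eq: "\<chi> e = \<chi> f"
    then obtain a b c d where e: "e = {a, b}" "a \<in> H" "b \<in> H" "a \<noteq> b" and f: "f = {c, d}" "c \<in> H" "d \<in> H" "c \<noteq> d"
      by (auto simp: nsets_2_eq)
    show "e = f"
    proof (rule ccontr)
      assume ne: "e \<noteq> f"
      consider "distinct [a, b, c, d]" | "a = c" | "a = d" | "b = c" | "b = d" using e f by auto
      then show False
      proof cases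
        case 1
        then show False using R e f eq by blast
      next
        case 2
        then show False using R[THEN conjunct1, rule_format, of a b d] e f eq ne by auto
      next
        case 3
        then show False using R[THEN conjunct1, rule_format, of a b c] e f eq ne by (auto simp: insert_commute)
      next
        case 4
        then show False using R[THEN conjunct1, rule_format, of b a d] e f eq ne by (auto simp: insert_commute)
      next
        case 5
        then show False using R[THEN conjunct1, rule_format, of b a c] e f eq ne by (auto simp: insert_commute)
      qed
    qed
  qed
qed

text \<open>Here \<open>ex_independent\<close> is used with 3 d for \<open>D\<close>: a 4-set in
  \<open>E\<close> through a triple \<open>S\<close> adds a vertex whose edge to some
  \<open>s\<close> in \<open>S\<close> has the color of \<open>S - {s}\<close>, which leaves 3
  choices of \<open>s\<close> and at most \<open>d\<close> of the vertex.\<close>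

lemma ex_rainbow_clique:
  fixes \<chi> :: "'a set \<Rightarrow> 'c" and d :: real
  assumes adm: "admissible r K q" and r: "3 \<le> r" and V: "finite V" and d: "1 \<le> d"
    and deg: "\<And>v k. v \<in> V \<Longrightarrow> real (card {u\<in>V - {v}. \<chi> {v, u} = k}) \<le> d"
    and large: "98304 * real r ^ 3 / ln (real r) * d \<le> real (card V)"
  shows "\<exists>H\<in>[V]\<^bsup>r\<^esup>. rainbow_clique \<chi> H"
proof -
  define E where "E = {{a, b, c, x} | a b c x. {a, b, c, x} \<subseteq> V \<and> distinct [a, b, c, x] \<and> \<chi> {a, b} = \<chi> {c, x}}"
  define F where "F = {{a, b, c} | a b c. {a, b, c} \<subseteq> V \<and> distinct [a, b, c] \<and> \<chi> {a, b} = \<chi> {a, c}}"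
  have lnr: "0 < ln (real r)" using r by simp
  interpret sparse_hypergraph V E F "3 * d"
  proof
    show "finite V" by fact
    show "E \<subseteq> [V]\<^bsup>4\<^esup>" by (auto simp: E_def nsets_def)
    show "F \<subseteq> [V]\<^bsup>3\<^esup>" by (auto simp: F_def nsets_def)
    show "0 \<le> 3 * d" using d by simp
  next
    fix S assume S: "S \<in> [V]\<^bsup>3\<^esup>"
    have fS: "finite S" "card S = 3" "S \<subseteq> V" using S by (auto simp: nsets_def)
    \<comment> \<open>Candidates for the fourth vertex when it is paired with
      \<open>s\<close>.\<close>
    define T where "T s = {x\<in>V - {s}. \<chi> {s, x} = \<chi> (S - {s})}" for s
    have finT: "finite (\<Union>s\<in>S. T s)" using V fS by (auto simp: T_def)
    have "{e\<in>E. S \<subseteq> e} \<subseteq> (\<lambda>x. insert x S) ` (\<Union>s\<in>S. T s)"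
    proof
      fix e assume e: "e \<in> {e\<in>E. S \<subseteq> e}"
      then obtain a b c x where abc: "e = {a, b, c, x}" "e \<subseteq> V" "distinct [a, b, c, x]" "\<chi> {a, b} = \<chi> {c, x}"
        unfolding E_def by blast
      have "card e = 4" "finite e" using abc by auto
      hence "card (e - S) = 1" using fS e by (simp add: card_Diff_subset)
      then obtain y where y: "e - S = {y}" by (rule card_1_singletonE)
      have eS: "e = insert y S" "S = e - {y}" using y e by blast+
      have "y \<in> (\<Union>s\<in>S. T s)"
      proof -
        consider "y = a" | "y = b" | "y = c" | "y = x" using y abc by blast
        then show ?thesis
        proof cases
          case 1
          have "b \<in> S" "S - {b} = {c, x}" using eS(2) abc(1,3) 1 by auto
          hence "y \<in> T b" using 1 abc by (auto simp: T_def insert_commute)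
          thus ?thesis using \<open>b \<in> S\<close> by blast
        next
          case 2
          have "a \<in> S" "S - {a} = {c, x}" using eS(2) abc(1,3) 2 by auto
          hence "y \<in> T a" using 2 abc by (auto simp: T_def insert_commute)
          thus ?thesis using \<open>a \<in> S\<close> by blast
        next
          case 3
          have "x \<in> S" "S - {x} = {a, b}" using eS(2) abc(1,3) 3 by auto
          hence "y \<in> T x" using 3 abc(1-3) abc(4)[symmetric] by (auto simp: T_def insert_commute)
          thus ?thesis using \<open>x \<in> S\<close> by blast
        next
          case 4
          have "c \<in> S" "S - {c} = {a, b}" using eS(2) abc(1,3) 4 by auto
          hence "y \<in> T c" using 4 abc(1-3) abc(4)[symmetric] by (auto simp: T_def insert_commute)
          thus ?thesis using \<open>c \<in> S\<close> by blast
        qed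
      qed
      thus "e \<in> (\<lambda>x. insert x S) ` (\<Union>s\<in>S. T s)" using eS(1) by (rule rev_image_eqI)
    qed
    hence "card {e\<in>E. S \<subseteq> e} \<le> card (\<Union>s\<in>S. T s)"
      using finT by (meson card_image_le card_mono finite_imageI le_trans)
    also have "\<dots> \<le> (\<Sum>s\<in>S. card (T s))" using fS by (intro card_UN_le)
    finally have "real (card {e\<in>E. S \<subseteq> e}) \<le> (\<Sum>s\<in>S. real (card (T s)))"
      by (metis of_nat_mono of_nat_sum)
    also have "\<dots> \<le> (\<Sum>s\<in>S. d)"
      using fS deg unfolding T_def by (intro sum_mono) auto
    finally show "real (card {e\<in>E. S \<subseteq> e}) \<le> 3 * d" using fS by simp
  next
    \<comment> \<open>Pairs \<open>(a, b)\<close> with \<open>b = a\<close> may stay in the count,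
      because \<open>deg\<close> bounds the neighbors of \<open>a\<close> in every color.\<close>
    define I where "I = Sigma V (\<lambda>a. Sigma V (\<lambda>b. {c\<in>V - {a}. \<chi> {a, c} = \<chi> {a, b}}))"
    have finI: "finite I" unfolding I_def using V by auto
    have "F \<subseteq> (\<lambda>(a, b, c). {a, b, c}) ` I"
    proof
      fix t assume "t \<in> F"
      then obtain a b c where "t = {a, b, c}" "(a, b, c) \<in> I"
        by (auto simp: F_def I_def)
      thus "t \<in> (\<lambda>(a, b, c). {a, b, c}) ` I" by (intro rev_image_eqI) auto
    qed
    hence "card F \<le> card I"
      using finI by (meson card_image_le card_mono finite_imageI le_trans)
    hence "real (card F) \<le> real (card I)" by simp
    also have "\<dots> \<le> real (card V) * (real (card V) * d)"
      unfolding I_def using V deg by (intro card_SigmaI_le) auto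
    also have "\<dots> = d * real (card V) ^ 2" by (simp add: power2_eq_square)
    also have "\<dots> \<le> 3 * d * real (card V) ^ 2" using d by (intro mult_right_mono) auto
    finally show "real (card F) \<le> 3 * d * real (card V) ^ 2" .
  qed
  \<comment> \<open>98304 = 3 * 32768, and the factor 3 is that of the degree bound 3 d.\<close>
  let ?Y = "32768 * real r ^ 3 / ln (real r)"
  have Y: "0 < ?Y" using r lnr by simp
  have nY: "?Y * (3 * d) \<le> n" using large by simp
  moreover have "?Y * 1 \<le> ?Y * (3 * d)" using Y d by (intro mult_left_mono) linarith+
  ultimately have qn: "q \<le> n" using adm unfolding admissible_def by linarith
  have n: "0 < n" using nY mult_pos_pos[of ?Y "3 * d"] Y d by linarith
  have "3 * d \<le> n / ?Y" using nY by (simp only: pos_le_divide_eq[OF Y] mult.commute[of "3 * d"])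
  hence "3 * d / n \<le> 1 / ?Y"
    by (simp only: pos_divide_le_eq[OF n] times_divide_eq_left mult_1_left)
  hence a: "3 * d / n \<le> ln (real r) / (32768 * real r ^ 3)" by simp
  have "0 \<le> 3 * d / n" using d by simp
  note adm' = adm[unfolded admissible_def]
  have "\<exists>H\<in>[V]\<^bsup>r\<^esup>. indep E H \<and> indep F H"
  proof (rule ex_independent)
    show "1 \<le> q" "1 \<le> K" "256 * 2 ^ K * real r < q" using adm' by simp_all
    show "exp (- (q / 4)) + 72 / q * (3 * d / n * q ^ 3 + 16 * (3 * d / n) ^ 2 * q ^ 6
        + 16 * (3 * d / n) ^ 2 * q ^ 5 + 64 * (3 * d / n) ^ 3 * q ^ 9)
        + real r * q ^ r * exp (2 * q * real r ^ 3 * (3 * d / n) / real K - q / 256) < 1"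
      by (rule adm'[THEN conjunct2, THEN conjunct2, THEN conjunct2, THEN conjunct2, rule_format]) fact+
  qed (rule qn)
  then obtain H where H: "H \<in> [V]\<^bsup>r\<^esup>" "indep E H" "indep F H" by blast
  have "H \<subseteq> V" using H by (simp add: nsets_def)
  have "rainbow_clique \<chi> H"
    unfolding rainbow_clique_iff
  proof (intro conjI ballI impI notI)
    fix a b c assume "a \<in> H" "b \<in> H" "c \<in> H" "distinct [a, b, c]" "\<chi> {a, b} = \<chi> {a, c}"
    moreover from this have "{a, b, c} \<subseteq> H" "{a, b, c} \<subseteq> V" using \<open>H \<subseteq> V\<close> by auto
    ultimately have "{a, b, c} \<in> F" unfolding F_def by blast
    thus False using H(3) \<open>{a, b, c} \<subseteq> H\<close> unfolding indep_def by blast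
  next
    fix a b c x assume "a \<in> H" "b \<in> H" "c \<in> H" "x \<in> H" "distinct [a, b, c, x]" "\<chi> {a, b} = \<chi> {c, x}"
    moreover from this have "{a, b, c, x} \<subseteq> H" "{a, b, c, x} \<subseteq> V" using \<open>H \<subseteq> V\<close> by auto
    ultimately have "{a, b, c, x} \<in> E" unfolding E_def by blast
    thus False using H(2) \<open>{a, b, c, x} \<subseteq> H\<close> unfolding indep_def by blast
  qed
  thus ?thesis using H by blast
qed

text \<open>Induction on \<open>k\<close>. A vertex with more than X^k neighbors in one color is put
  in front of an orderable clique found among these neighbors; without such a vertex,
  \<open>ex_rainbow_clique\<close> applies with d = X^k. For k = 0 any two vertices are
  orderable.\<close>

lemma ex_orderable_or_rainbow:
  fixes \<chi> :: "'a set \<Rightarrow> 'c"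
  defines "X \<equiv> \<lambda>r. 98304 * real r ^ 3 / ln (real r)"
  assumes adm: "admissible r K q" and r: "3 \<le> r" and X: "1 \<le> X r"
    and V: "finite V" "X r ^ k < real (card V)"
  shows "(\<exists>H\<in>[V]\<^bsup>(k + 2)\<^esup>. orderable_clique \<chi> H) \<or> (\<exists>H\<in>[V]\<^bsup>r\<^esup>. rainbow_clique \<chi> H)"
  using V
proof (induction k arbitrary: V)
  case 0
  hence "2 \<le> card V" by simp
  then obtain H where H: "H \<subseteq> V" "card H = 2" by (meson obtain_subset_with_card_n)
  then obtain a b where ab: "H = {a, b}" "a \<noteq> b" by (meson card_2_iff)
  have "orderable_clique \<chi> H"
    unfolding orderable_clique_def using ab by (intro exI[of _ "[a, b]"]) auto
  moreover have "H \<in> [V]\<^bsup>2\<^esup>" using H ab by (auto simp: nsets_def)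
  ultimately show ?case unfolding add_0 by blast
next
  case (Suc k)
  show ?case
  proof (cases "\<exists>v\<in>V. \<exists>c. X r ^ k < real (card {u\<in>V - {v}. \<chi> {v, u} = c})")
    case True
    then obtain v c where v: "v \<in> V" "X r ^ k < real (card {u\<in>V - {v}. \<chi> {v, u} = c})" by blast
    define N where "N = {u\<in>V - {v}. \<chi> {v, u} = c}"
    have N: "finite N" "N \<subseteq> V" "v \<notin> N" "\<And>u. u \<in> N \<Longrightarrow> \<chi> {v, u} = c"
      using Suc.prems by (auto simp: N_def)
    have "(\<exists>H\<in>[N]\<^bsup>(k + 2)\<^esup>. orderable_clique \<chi> H) \<or> (\<exists>H\<in>[N]\<^bsup>r\<^esup>. rainbow_clique \<chi> H)"
      using v by (intro Suc.IH N) (simp add: N_def)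
    thus ?thesis
    proof
      assume "\<exists>H\<in>[N]\<^bsup>(k + 2)\<^esup>. orderable_clique \<chi> H"
      then obtain H vs where H: "H \<in> [N]\<^bsup>(k + 2)\<^esup>" and vs: "distinct vs" "set vs = H"
        "\<And>i j l. i < j \<Longrightarrow> j < l \<Longrightarrow> l < length vs \<Longrightarrow> \<chi> {vs ! i, vs ! j} = \<chi> {vs ! i, vs ! l}"
        unfolding orderable_clique_def by blast
      have HN: "H \<subseteq> N" "finite H" "card H = k + 2" using H by (auto simp: nsets_def)
      have nthN: "\<chi> {v, vs ! i} = c" if "i < length vs" for i
        using N(4) vs(2) HN(1) nth_mem[OF that] by blast
      \<comment> \<open>Index 0 is \<open>v\<close>, whose edges to \<open>N\<close> all have color
        \<open>c\<close>; positive indices shift by one to \<open>vs\<close>.\<close>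
      have "\<chi> {(v # vs) ! i, (v # vs) ! j} = \<chi> {(v # vs) ! i, (v # vs) ! l}"
        if "i < j" "j < l" "l < length (v # vs)" for i j l
      proof -
        obtain j' l' where jl: "j = Suc j'" "l = Suc l'"
          using \<open>i < j\<close> \<open>j < l\<close> by (cases j; cases l) auto
        show ?thesis
        proof (cases i)
          case 0
          then show ?thesis using jl that nthN by simp
        next
          case (Suc i')
          then show ?thesis using jl that vs(3)[of i' j' l'] by simp
        qed
      qed
      moreover have "distinct (v # vs)" "set (v # vs) = insert v H" using vs HN N by auto
      ultimately have "orderable_clique \<chi> (insert v H)"
        unfolding orderable_clique_def by blast
      moreover have "insert v H \<in> [V]\<^bsup>(Suc k + 2)\<^esup>"
        using HN N v by (auto simp: nsets_def card_insert_if)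
      ultimately show ?thesis by blast
    next
      assume "\<exists>H\<in>[N]\<^bsup>r\<^esup>. rainbow_clique \<chi> H"
      thus ?thesis using nsets_mono[OF N(2), of r] by blast
    qed
  next
    case False
    have "\<exists>H\<in>[V]\<^bsup>r\<^esup>. rainbow_clique \<chi> H"
    proof (rule ex_rainbow_clique[OF adm r])
      show "1 \<le> X r ^ k" using X by (rule one_le_power)
      show "98304 * real r ^ 3 / ln (real r) * X r ^ k \<le> real (card V)"
        using Suc.prems by (simp add: X_def)
    qed (use False Suc.prems in \<open>auto simp: not_less\<close>)
    thus ?thesis by blast
  qed
qed

section \<open>From large \<open>r\<close> to all \<open>r\<close>\<close>

theorem theorem1p2:
  shows "\<exists>c::real. c > 0 \<and>
    (\<forall>m r :: nat. m \<ge> 3 \<longrightarrow> r \<ge> 3 \<longrightarrow>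
       ereal_of_enat (CR m r) \<le> ereal ((c * real r ^ 3 / ln (real r)) ^ (m - 2)))"
proof -
  define X where "X r = 98304 * real r ^ 3 / ln (real r)" for r :: nat
  obtain r0 where r0: "\<And>r. r0 \<le> r \<Longrightarrow> \<exists>K q. admissible r K q"
    using eventually_admissible unfolding eventually_sequentially by blast
  define r1 where "r1 = max r0 3"
  have cube: "1 \<le> real r ^ 3 / ln (real r)" if "3 \<le> r" for r
  proof -
    have "0 < ln (real r)" using that by simp
    moreover have "ln (real r) \<le> real r" using that ln_le_minus_one[of "real r"] by simp
    moreover have "real r \<le> real r ^ 3" using that by (intro self_le_power) auto
    ultimately have "0 < ln (real r)" "ln (real r) \<le> real r ^ 3" by linarith+
    thus ?thesis by (simp only: pos_le_divide_eq mult_1_left)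
  qed
  have X1: "1 \<le> X r" if "3 \<le> r" for r using cube[OF that] by (simp add: X_def)
  \<comment> \<open>The first summand serves \<open>r >= r1\<close>. The second serves the finitely
    many smaller \<open>r\<close>, where the bound for \<open>r1\<close> is used and r^3 / ln r >=
    1.\<close>
  define c where "c = 2 * 98304 + 2 * X r1"
  have Xr1: "1 \<le> X r1" by (rule X1) (simp add: r1_def)
  have bound: "2 * X (max r r1) \<le> c * real r ^ 3 / ln (real r)" if r: "3 \<le> r" for r
  proof (cases "r1 \<le> r")
    case True
    have "2 * 98304 * (real r ^ 3 / ln (real r)) \<le> c * (real r ^ 3 / ln (real r))"
      using cube[OF r] Xr1 by (intro mult_right_mono) (auto simp: c_def)
    thus ?thesis using True by (simp add: X_def max_def)
  next
    case False
    have "2 * X r1 * 1 \<le> c * (real r ^ 3 / ln (real r))"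
      using cube[OF r] Xr1 by (intro mult_mono) (auto simp: c_def)
    thus ?thesis using False by (simp add: max_def)
  qed
  have "ereal_of_enat (CR m r) \<le> ereal ((c * real r ^ 3 / ln (real r)) ^ (m - 2))"
    if m: "3 \<le> m" and r: "3 \<le> r" for m r
  proof -
    define k where "k = m - 2"
    have k: "1 \<le> k" "m = k + 2" using m by (auto simp: k_def)
    \<comment> \<open>A rainbow clique of order \<open>s >= r\<close> contains one of order
      \<open>r\<close>, so small \<open>r\<close> can be raised to \<open>r1\<close>.\<close>
    define s where "s = max r r1"
    have s: "3 \<le> s" "r \<le> s" "r0 \<le> s" using r by (auto simp: s_def r1_def)
    define y where "y = (c * real r ^ 3 / ln (real r)) ^ k"
    \<comment> \<open>The spare factor 2 makes room for rounding: y >= X^k + 1, so the integer part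
      of \<open>y\<close> still exceeds X^k.\<close>
    have "2 * X s ^ k \<le> 2 ^ k * X s ^ k"
      using k X1[OF s(1)] self_le_power[of "2::real" k] by (intro mult_right_mono) auto
    also have "\<dots> \<le> y"
      unfolding y_def power_mult_distrib[symmetric] using bound[OF r] X1[OF s(1)]
      by (intro power_mono) (auto simp: s_def)
    finally have y: "2 * X s ^ k \<le> y" .
    have Xk: "1 \<le> X s ^ k" using X1[OF s(1)] by (rule one_le_power)
    define n where "n = nat \<lfloor>y\<rfloor>"
    have n: "real n \<le> y" "X s ^ k < real n" using y Xk unfolding n_def by linarith+
    obtain K q where adm: "admissible s K q" using r0[OF s(3)] by blast
    have "CR_arrows n m r"
      unfolding CR_arrows_def
    proof
      fix \<chi> :: "nat set \<Rightarrow> nat"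
      have "(\<exists>H\<in>[{..<n}]\<^bsup>(k + 2)\<^esup>. orderable_clique \<chi> H) \<or> (\<exists>H\<in>[{..<n}]\<^bsup>s\<^esup>. rainbow_clique \<chi> H)"
        using n X1[OF s(1)] by (intro ex_orderable_or_rainbow[OF adm s(1)]) (auto simp: X_def)
      moreover have "\<exists>H\<in>[{..<n}]\<^bsup>r\<^esup>. rainbow_clique \<chi> H" if "H \<in> [{..<n}]\<^bsup>s\<^esup>" "rainbow_clique \<chi> H" for H
      proof -
        have H: "H \<subseteq> {..<n}" "card H = s" using that by (auto simp: nsets_def)
        then obtain S where S: "S \<subseteq> H" "card S = r" "finite S"
          using s by (metis obtain_subset_with_card_n)
        hence "S \<in> [{..<n}]\<^bsup>r\<^esup>" using H by (auto simp: nsets_def)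
        thus ?thesis using rainbow_clique_subset[OF that(2) S(1)] by blast
      qed
      ultimately show "(\<exists>H\<in>[{..<n}]\<^bsup>m\<^esup>. orderable_clique \<chi> H) \<or> (\<exists>H\<in>[{..<n}]\<^bsup>r\<^esup>. rainbow_clique \<chi> H)"
        using k by blast
    qed
    hence "CR m r \<le> enat n" unfolding CR_def by (intro Inf_lower) auto
    hence "ereal_of_enat (CR m r) \<le> ereal_of_enat (enat n)" by (simp only: ereal_of_enat_le_iff)
    also have "\<dots> \<le> ereal y" using n by simp
    finally show ?thesis by (simp add: y_def k_def)
  qed
  moreover have "0 < c" using Xr1 by (simp add: c_def)
  ultimately show ?thesis by blast
qed

end
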